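(* Let $K$ be a continuous translation-invariant, Fourier-transformable (strictly) positive definite kernel on $\mathbb R^d$ with strictly positive Fourier transform $\hat K$, whose native Hilbert space $\mathcal H_K$ is continuously embedded in $L_2(\mathbb R^d)$, and let $\Omega\subset\mathbb R^d$ be a domain. Then the functions $f\in\mathcal H_{K*K}\cap\mathcal H_K(\Omega)$, i.e. those with superconvergence, are strong solutions of $$L_{K*K}f=v\quad\text{in }\mathbb R^d$$ with a function $v\in L_2(\Omega)$ extended by zero to $\mathbb R^d$.
   Context: Constant multipliers in Fourier transform formulas are ignored; $g\mapsto g^\vee$ is the inverse Fourier transform. $\mathcal H_K$ is the reproducing kernel Hilbert space on $\mathbb R^d$ with kernel $K(x-y)$ and inner product $(f,g)_K=\int_{\mathbb R^d}\hat f\,\overline{\hat g}/\hat K$. $\mathcal H_{K*K}$ is the space of all $f=K*v_f$ with $v_f\in L_2(\mathbb R^d)$, i.e. of all $f$ with $\hat f/\hat K\in L_2(\mathbb R^d)$, and $L_{K*K}:\mathcal H_{K*K}\to L_2(\mathbb R^d)$ is the pseudodifferential operator $L_{K*K}f=(\hat f/\hat K)^\vee$, so that $v_f=L_{K*K}f$. A strong solution of $L_{K*K}f=v$ is an $f\in\mathcal H_{K*K}$ for which the equation holds as an equation in $L_2(\mathbb R^d)$. $\mathcal H_K(\Omega):=Z_K(\Omega)^\perp$ is the orthogonal complement in $\mathcal H_K$ of $Z_K(\Omega)=\{f\in\mathcal H_K: f=0\text{ on }\Omega\}$; it is the $\mathcal H_K$-closure of the span of the kernel translates $K(\cdot-x)$,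 $x\in\Omega$. Superconvergence refers to the following: whenever $\Pi_K$ is a best-approximation (orthogonal) projector of $\mathcal H_K$ onto a closed subspace of $\mathcal H_K(\Omega)$ with a standard error bound $\|g-\Pi_Kg\|_{L_2(\Omega)}\le\epsilon\|g-\Pi_Kg\|_K$ for all $g\in\mathcal H_K$, the function $f$ satisfies the improved bound $\|f-\Pi_Kf\|_{L_2(\Omega)}\le\epsilon^2\|v_f\|_{L_2(\mathbb R^d)}$.
   Formalization: Superconvergence of f is assumed in addition to f in H_{K*K} ∩ H_K(Ω), not treated as equivalent to it: for the Gaussian, H_K(Ω)=H_K, so f=K*v with v nonzero off Ω lies in the intersection but violates the claim. *)

theory Defs
  imports "HOL-Analysis.Analysis"
begin

subsection \<open>Square integrable functions and the Fourier transform on $L_2$\<close>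

definition L2_on :: "'a::euclidean_space set \<Rightarrow> ('a \<Rightarrow> complex) \<Rightarrow> bool" where
  "L2_on \<Omega> f \<longleftrightarrow> set_borel_measurable lborel \<Omega> f \<and> set_integrable lborel \<Omega> (\<lambda>x. (norm (f x))\<^sup>2)"

definition L2_norm_on :: "'a::euclidean_space set \<Rightarrow> ('a \<Rightarrow> complex) \<Rightarrow> real" where
  "L2_norm_on \<Omega> f = sqrt (LINT x:\<Omega>|lborel. (norm (f x))\<^sup>2)"

definition zero_ext :: "'a set \<Rightarrow> ('a \<Rightarrow> complex) \<Rightarrow> 'a \<Rightarrow> complex" where
  "zero_ext \<Omega> v = (\<lambda>x. if x \<in> \<Omega> then v x else 0)"

text \<open>
  The transform of a square integrable function is the limit in $L_2$ of the Fourier integrals over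
  growing balls. It is determined up to null sets, and the operators below select a representative.
  The exponent carries the factor $2 \pi$, so that the transform is unitary, convolutions
  become products, and no constant multipliers arise in any of the formulas used below.
\<close>

definition L2_fourier :: "('a::euclidean_space \<Rightarrow> complex) \<Rightarrow> 'a \<Rightarrow> complex" where
  "L2_fourier f = (SOME \<phi>. L2_on UNIV \<phi> \<and>
     (\<lambda>n::nat. L2_norm_on UNIV
        (\<lambda>\<omega>. \<phi> \<omega> - (LINT x:cball 0 (real n)|lborel. cis (- (2 * pi * (x \<bullet> \<omega>))) * f x)))
     \<longlonglongrightarrow> 0)"

definition L2_inv_fourier :: "('a::euclidean_space \<Rightarrow> complex) \<Rightarrow> 'a \<Rightarrow> complex" where
  "L2_inv_fourier g = (SOME f. L2_on UNIV f \<and>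
     (\<lambda>n::nat. L2_norm_on UNIV
        (\<lambda>x. f x - (LINT \<omega>:cball 0 (real n)|lborel. cis (2 * pi * (x \<bullet> \<omega>)) * g \<omega>)))
     \<longlonglongrightarrow> 0)"


subsection \<open>Reproducing kernel Hilbert spaces of complex functions\<close>

text \<open>
  A Hilbert space of functions is given by its carrier \<open>H\<close> and its inner product \<open>ip\<close>, linear
  in the first argument. Its elements are functions, not classes modulo null sets.
\<close>

definition fun_subspace :: "('a \<Rightarrow> complex) set \<Rightarrow> bool" where
  "fun_subspace V \<longleftrightarrow> (\<lambda>x. 0) \<in> V \<and> (\<forall>f\<in>V. \<forall>g\<in>V. (\<lambda>x. f x + g x) \<in> V) \<and>
     (\<forall>f\<in>V. \<forall>c. (\<lambda>x. c * f x) \<in> V)"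

type_synonym 'a inner_product = "('a \<Rightarrow> complex) \<Rightarrow> ('a \<Rightarrow> complex) \<Rightarrow> complex"

definition ip_norm :: "'a inner_product \<Rightarrow> ('a \<Rightarrow> complex) \<Rightarrow> real" where
  "ip_norm ip f = sqrt (Re (ip f f))"

definition inner_product_on :: "('a \<Rightarrow> complex) set \<Rightarrow> 'a inner_product \<Rightarrow> bool" where
  "inner_product_on H ip \<longleftrightarrow>
     (\<forall>f\<in>H. \<forall>g\<in>H. \<forall>h\<in>H. ip (\<lambda>x. f x + g x) h = ip f h + ip g h) \<and>
     (\<forall>f\<in>H. \<forall>h\<in>H. \<forall>c. ip (\<lambda>x. c * f x) h = c * ip f h) \<and>
     (\<forall>f\<in>H. \<forall>g\<in>H. ip g f = cnj (ip f g)) \<and>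
     (\<forall>f\<in>H. 0 \<le> Re (ip f f) \<and> (ip f f = 0 \<longrightarrow> f = (\<lambda>x. 0)))"

definition ip_complete :: "('a \<Rightarrow> complex) set \<Rightarrow> 'a inner_product \<Rightarrow> bool" where
  "ip_complete H ip \<longleftrightarrow>
     (\<forall>s::nat \<Rightarrow> 'a \<Rightarrow> complex. (\<forall>n. s n \<in> H) \<and>
        (\<forall>e>0. \<exists>N. \<forall>m\<ge>N. \<forall>n\<ge>N. ip_norm ip (\<lambda>x. s m x - s n x) < e) \<longrightarrow>
        (\<exists>l\<in>H. (\<lambda>n. ip_norm ip (\<lambda>x. s n x - l x)) \<longlonglongrightarrow> 0))"

definition rkhs :: "('a \<Rightarrow> complex) set \<Rightarrow> 'a inner_product \<Rightarrow> ('a \<Rightarrow> 'a \<Rightarrow> complex) \<Rightarrow> bool" where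
  "rkhs H ip k \<longleftrightarrow> fun_subspace H \<and> inner_product_on H ip \<and> ip_complete H ip \<and>
     (\<forall>y. (\<lambda>x. k x y) \<in> H) \<and> (\<forall>f\<in>H. \<forall>y. f y = ip f (\<lambda>x. k x y))"

definition closed_subspace :: "('a \<Rightarrow> complex) set \<Rightarrow> 'a inner_product \<Rightarrow> ('a \<Rightarrow> complex) set \<Rightarrow> bool"
  where "closed_subspace H ip V \<longleftrightarrow> V \<subseteq> H \<and> fun_subspace V \<and>
     (\<forall>(s::nat \<Rightarrow> 'a \<Rightarrow> complex) l. (\<forall>n. s n \<in> V) \<and> l \<in> H \<and>
        (\<lambda>n. ip_norm ip (\<lambda>x. s n x - l x)) \<longlonglongrightarrow> 0 \<longrightarrow> l \<in> V)"

definition orth_projector ::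
  "('a \<Rightarrow> complex) set \<Rightarrow> 'a inner_product \<Rightarrow> ('a \<Rightarrow> complex) set \<Rightarrow>
   (('a \<Rightarrow> complex) \<Rightarrow> ('a \<Rightarrow> complex)) \<Rightarrow> bool" where
  "orth_projector H ip V P \<longleftrightarrow>
     (\<forall>g\<in>H. P g \<in> V \<and> (\<forall>h\<in>V. ip (\<lambda>x. g x - P g x) h = 0))"

definition vanishing_on :: "('a \<Rightarrow> complex) set \<Rightarrow> 'a set \<Rightarrow> ('a \<Rightarrow> complex) set" where
  "vanishing_on H \<Omega> = {f \<in> H. \<forall>x\<in>\<Omega>. f x = 0}"

definition localized ::
  "('a \<Rightarrow> complex) set \<Rightarrow> 'a inner_product \<Rightarrow> 'a set \<Rightarrow> ('a \<Rightarrow> complex) set" where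
  "localized H ip \<Omega> = {f \<in> H. \<forall>z\<in>vanishing_on H \<Omega>. ip f z = 0}"

definition continuously_embedded_L2 ::
  "('a::euclidean_space \<Rightarrow> complex) set \<Rightarrow> 'a inner_product \<Rightarrow> bool" where
  "continuously_embedded_L2 H ip \<longleftrightarrow>
     (\<forall>f\<in>H. L2_on UNIV f) \<and> (\<exists>C. \<forall>f\<in>H. L2_norm_on UNIV f \<le> C * ip_norm ip f)"


subsection \<open>Translation-invariant kernels\<close>

definition strictly_positive_definite :: "('a::ab_group_add \<Rightarrow> complex) \<Rightarrow> bool" where
  "strictly_positive_definite K \<longleftrightarrow>
     (\<forall>X c. finite X \<and> (\<exists>x\<in>X. c x \<noteq> 0) \<longrightarrow>
        (let q = (\<Sum>x\<in>X. \<Sum>y\<in>X. c x * cnj (c y) * K (x - y)) in Im q = 0 \<and> 0 < Re q))"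

text \<open>
  By the reproducing property, a Hilbert space with reproducing kernel \<open>K (x - y)\<close> is unique, so
  the predicate below describes one space with one inner product.
\<close>

definition native_space ::
  "('a::euclidean_space \<Rightarrow> complex) \<Rightarrow> ('a \<Rightarrow> complex) set \<Rightarrow> 'a inner_product \<Rightarrow> bool" where
  "native_space K H ip \<longleftrightarrow> rkhs H ip (\<lambda>x y. K (x - y)) \<and>
     (\<forall>f\<in>H. \<forall>g\<in>H. has_bochner_integral lborel
        (\<lambda>\<omega>. L2_fourier f \<omega> * cnj (L2_fourier g \<omega>) / L2_fourier K \<omega>) (ip f g))"

definition conv_space :: "('a::euclidean_space \<Rightarrow> complex) \<Rightarrow> ('a \<Rightarrow> complex) set" where
  "conv_space K = {f. \<exists>v. L2_on UNIV v \<and> (\<forall>x. f x = (LINT y|lborel. K (x - y) * v y))}"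

definition pseudo_op :: "('a::euclidean_space \<Rightarrow> complex) \<Rightarrow> ('a \<Rightarrow> complex) \<Rightarrow> 'a \<Rightarrow> complex" where
  "pseudo_op K f = L2_inv_fourier (\<lambda>\<omega>. L2_fourier f \<omega> / L2_fourier K \<omega>)"

definition strong_solution ::
  "('a::euclidean_space \<Rightarrow> complex) \<Rightarrow> ('a \<Rightarrow> complex) \<Rightarrow> ('a \<Rightarrow> complex) \<Rightarrow> bool" where
  "strong_solution K v f \<longleftrightarrow> f \<in> conv_space K \<and> L2_on UNIV v \<and> (AE x in lborel. pseudo_op K f x = v x)"

text \<open>
  For \<open>f = K * v\<close> one has \<open>pseudo_op K f = v\<close> almost everywhere, so the last norm below is that of
  the convolution factor of \<open>f\<close>.
\<close>

definition superconvergent ::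
  "('a::euclidean_space \<Rightarrow> complex) \<Rightarrow> ('a \<Rightarrow> complex) set \<Rightarrow> 'a inner_product \<Rightarrow> 'a set \<Rightarrow>
   ('a \<Rightarrow> complex) \<Rightarrow> bool" where
  "superconvergent K H ip \<Omega> f \<longleftrightarrow>
     (\<forall>V P \<epsilon>. closed_subspace H ip V \<and> V \<subseteq> localized H ip \<Omega> \<and> orth_projector H ip V P \<and> 0 < \<epsilon> \<and>
        (\<forall>g\<in>H. L2_norm_on \<Omega> (\<lambda>x. g x - P g x) \<le> \<epsilon> * ip_norm ip (\<lambda>x. g x - P g x)) \<longrightarrow>
        L2_norm_on \<Omega> (\<lambda>x. f x - P f x) \<le> \<epsilon>\<^sup>2 * L2_norm_on UNIV (pseudo_op K f))"

end

theory Submission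
  imports Defs "HOL-Probability.Characteristic_Functions"
begin

text \<open>
  Let \<open>f\<close> be the convolution of \<open>K\<close> with a square integrable \<open>v\<close>. By the convolution theorem and
  Fourier inversion \<open>pseudo_op K f = v\<close> almost everywhere, so \<open>f\<close> solves the equation with right-hand
  side \<open>v\<close>, and everything rests on showing that \<open>v\<close> vanishes almost everywhere outside \<open>\<Omega>\<close>.

  Orthogonality of \<open>f\<close> to the functions that vanish on \<open>\<Omega>\<close> cannot give this alone: if \<open>K\<close> is a
  Gaussian, the native space \<open>H\<close> consists of analytic functions, no nonzero one of which vanishes on
  \<open>\<Omega>\<close>. The information comes from superconvergence, applied to projectors whose residuals are, on
  \<open>\<Omega>\<close>, multiples of one function. For a unit vector \<open>e\<close> of \<open>localized H ip \<Omega>\<close> let \<open>V\<close> be the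
  orthogonal complement of \<open>e\<close> in \<open>localized H ip \<Omega>\<close>. The residual of \<open>g\<close> agrees on \<open>\<Omega>\<close> with
  \<open>ip g e\<close> times \<open>e\<close>, so the standard error bound holds with \<open>\<epsilon>\<close> the norm of \<open>e\<close> in $L_2(\Omega)$,
  and the improved bound reads $|(f,e)_K|\,\epsilon \le \epsilon^2 \|v\|$. Dividing by \<open>\<epsilon>\<close> and
  extending from \<open>e\<close> to all of \<open>H\<close> gives $|(f,h)_K| \le \|v\|\,\|h\|_{L_2(\Omega)}$
  (\<open>superconvergent_bound\<close>).

  On the other hand $(f,h)_K$ is the $L_2$ inner product of \<open>v\<close> and \<open>h\<close> (\<open>ip_convolution\<close>), and \<open>H\<close> is
  dense in $L_2$ (\<open>H_dense_L2\<close>). Hence \<open>h\<close> may approach the part of \<open>v\<close> outside \<open>\<Omega>\<close>: the right-hand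
  side then tends to zero and the left-hand side to the squared norm of that part
  (\<open>convolution_factor_vanishes_outside\<close>).

  The harmonic analysis behind these facts is developed from the Fourier integral of a Gaussian. On
  functions that are integrable and square integrable the Fourier integral is an $L_2$ contraction
  (\<open>ftrans_contraction\<close>), so it extends to $L_2$. The extension is symmetric for the bilinear pairing
  (\<open>L2_multiplication_formula\<close>), it is inverted by the transform of opposite sign because this is so
  for Gaussians, which determine a function through their pairings with it (\<open>L2_ftrans_inverse\<close>), and
  Parseval's identity follows (\<open>L2_parseval\<close>).
\<close>

section \<open>Semi-inner products and orthogonal projections\<close>

text \<open>
  The two instances are the native space and the square integrable functions. On the latter the form
  is only semidefinite, since its elements are functions and not classes modulo null sets.
\<close>

locale semi_inner_product =
  fixes H :: "('b \<Rightarrow> complex) set" and ip :: "'b inner_product"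
  assumes subspace: "fun_subspace H"
    and add_left: "\<lbrakk>f \<in> H; g \<in> H; h \<in> H\<rbrakk> \<Longrightarrow> ip (\<lambda>x. f x + g x) h = ip f h + ip g h"
    and scale_left: "\<lbrakk>f \<in> H; h \<in> H\<rbrakk> \<Longrightarrow> ip (\<lambda>x. c * f x) h = c * ip f h"
    and hermitian: "\<lbrakk>f \<in> H; g \<in> H\<rbrakk> \<Longrightarrow> ip g f = cnj (ip f g)"
    and nonneg: "f \<in> H \<Longrightarrow> 0 \<le> Re (ip f f)"
begin

lemma add_mem: "\<lbrakk>f \<in> H; g \<in> H\<rbrakk> \<Longrightarrow> (\<lambda>x. f x + g x) \<in> H"
  and scale_mem: "f \<in> H \<Longrightarrow> (\<lambda>x. c * f x) \<in> H"
  using subspace by (auto simp: fun_subspace_def)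

lemma diff_mem: "\<lbrakk>f \<in> H; g \<in> H\<rbrakk> \<Longrightarrow> (\<lambda>x. f x - g x) \<in> H"
  using add_mem[of f "\<lambda>x. (-1) * g x"] scale_mem[of g "-1"] by simp

lemma diff_left:
  assumes "f \<in> H" "g \<in> H" "h \<in> H"
  shows "ip (\<lambda>x. f x - g x) h = ip f h - ip g h"
  using add_left[of f "\<lambda>x. (-1) * g x" h] scale_left[of g h "-1"] scale_mem[of g "-1"] assms
  by simp

lemma add_right:
  assumes "f \<in> H" "g \<in> H" "h \<in> H"
  shows "ip h (\<lambda>x. f x + g x) = ip h f + ip h g"
  using assms hermitian[of "\<lambda>x. f x + g x" h] hermitian[of f h] hermitian[of g h]
  by (simp add: add_left add_mem)

lemma scale_right:
  assumes "f \<in> H" "h \<in> H"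
  shows "ip h (\<lambda>x. c * f x) = cnj c * ip h f"
  using assms hermitian[of "\<lambda>x. c * f x" h] hermitian[of f h]
  by (simp add: scale_left scale_mem)

lemma diff_right:
  assumes "f \<in> H" "g \<in> H" "h \<in> H"
  shows "ip h (\<lambda>x. f x - g x) = ip h f - ip h g"
  using assms hermitian[of "\<lambda>x. f x - g x" h] hermitian[of f h] hermitian[of g h]
  by (simp add: diff_left diff_mem)

lemma norm_nonneg: "f \<in> H \<Longrightarrow> 0 \<le> ip_norm ip f"
  using nonneg by (simp add: ip_norm_def)

lemma norm_sq: "f \<in> H \<Longrightarrow> (ip_norm ip f)\<^sup>2 = Re (ip f f)"
  using nonneg by (simp add: ip_norm_def)

lemma ip_self: "f \<in> H \<Longrightarrow> ip f f = of_real ((ip_norm ip f)\<^sup>2)"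
  using norm_sq hermitian[of f f] by (simp add: complex_eq_iff)

lemma norm_sq_add_scale:
  assumes "f \<in> H" "g \<in> H"
  shows "(ip_norm ip (\<lambda>x. f x + c * g x))\<^sup>2 =
    (ip_norm ip f)\<^sup>2 + 2 * Re (cnj c * ip f g) + (cmod c)\<^sup>2 * (ip_norm ip g)\<^sup>2"
proof -
  have "ip (\<lambda>x. f x + c * g x) (\<lambda>x. f x + c * g x) =
     ip f f + cnj c * ip f g + (c * cnj (ip f g) + c * cnj c * ip g g)"
    using assms hermitian[of f g]
    by (simp add: add_left add_right scale_left scale_right add_mem scale_mem algebra_simps)
  then have "Re (ip (\<lambda>x. f x + c * g x) (\<lambda>x. f x + c * g x)) =
     Re (ip f f) + 2 * Re (cnj c * ip f g) + Re (c * cnj c * ip g g)"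
    by simp
  moreover have "Re (c * cnj c * ip g g) = (cmod c)\<^sup>2 * (ip_norm ip g)\<^sup>2"
    by (simp add: ip_self assms complex_mult_cnj cmod_def)
  ultimately show ?thesis
    using assms by (simp add: norm_sq add_mem scale_mem)
qed

text \<open>
  Minimising the norm of \<open>f - c g\<close> over \<open>c\<close> would need a division by the norm of \<open>g\<close>, which may
  vanish here for \<open>g\<close> other than zero. The scalars \<open>c = - t ip f g\<close> with a free \<open>t > 0\<close> avoid this.
\<close>

lemma ortho_of_minimal:
  assumes "f \<in> H" "g \<in> H"
    and "\<And>c. (ip_norm ip f)\<^sup>2 \<le> (ip_norm ip (\<lambda>x. f x + c * g x))\<^sup>2"
  shows "ip f g = 0"
proof (rule ccontr)
  assume a: "ip f g \<noteq> 0"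
  define N where "N = (ip_norm ip g)\<^sup>2"
  define t where "t = 1 / (N + 1)"
  have N: "N \<ge> 0" by (simp add: N_def)
  then have t: "t > 0" "t * N < 1" by (auto simp: t_def field_simps)
  let ?c = "- (of_real t * ip f g)"
  have r: "Re (cnj ?c * ip f g) = - t * (cmod (ip f g))\<^sup>2"
    by (simp add: cmod_def power2_eq_square algebra_simps)
  have "0 \<le> 2 * Re (cnj ?c * ip f g) + (cmod ?c)\<^sup>2 * N"
    using assms(3)[of ?c] norm_sq_add_scale[OF assms(1,2), of ?c] by (simp add: N_def)
  then have "0 \<le> (t * (cmod (ip f g))\<^sup>2) * (t * N - 2)"
    unfolding r using t by (simp add: norm_mult power_mult_distrib power2_eq_square algebra_simps)
  moreover have "0 < t * (cmod (ip f g))\<^sup>2" using t a by simp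
  ultimately have "0 \<le> t * N - 2"
    by (meson mult_pos_neg not_le)
  with t show False by linarith
qed

lemma cauchy_schwarz:
  assumes "f \<in> H" "g \<in> H"
  shows "cmod (ip f g) \<le> ip_norm ip f * ip_norm ip g"
proof (cases "ip_norm ip g = 0")
  case True
  then have "ip g f = 0" using assms by (intro ortho_of_minimal) auto
  then show ?thesis using hermitian[OF assms(2,1)] True by simp
next
  case False
  define N where "N = (ip_norm ip g)\<^sup>2"
  have N: "N > 0" using False by (simp add: N_def)
  let ?c = "- (of_real (1 / N) * ip f g)"
  have r: "Re (cnj ?c * ip f g) = - (1/N) * (cmod (ip f g))\<^sup>2"
    by (simp add: cmod_def power2_eq_square algebra_simps add_divide_distrib)
  have "0 \<le> (ip_norm ip f)\<^sup>2 + 2 * (- (1/N) * (cmod (ip f g))\<^sup>2) + (cmod ?c)\<^sup>2 * N"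
    using norm_sq_add_scale[OF assms, of ?c] unfolding r
    by (metis N_def zero_le_power2)
  also have "(cmod ?c)\<^sup>2 * N = (1/N) * (cmod (ip f g))\<^sup>2"
    using N by (simp add: norm_mult norm_divide power_divide power2_eq_square)
  finally have "(cmod (ip f g))\<^sup>2 \<le> (ip_norm ip f)\<^sup>2 * N"
    using N by (simp add: field_simps)
  then have "(cmod (ip f g))\<^sup>2 \<le> (ip_norm ip f * ip_norm ip g)\<^sup>2"
    by (simp add: N_def power_mult_distrib)
  then show ?thesis
    using norm_nonneg assms by (meson mult_nonneg_nonneg power2_le_imp_le)
qed

lemma norm_triangle:
  assumes "f \<in> H" "g \<in> H"
  shows "ip_norm ip (\<lambda>x. f x + g x) \<le> ip_norm ip f + ip_norm ip g"
proof (rule power2_le_imp_le)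
  have "(ip_norm ip (\<lambda>x. f x + g x))\<^sup>2 = (ip_norm ip f)\<^sup>2 + 2 * Re (ip f g) + (ip_norm ip g)\<^sup>2"
    using norm_sq_add_scale[OF assms, of 1] by simp
  moreover have "Re (ip f g) \<le> ip_norm ip f * ip_norm ip g"
    using cauchy_schwarz[OF assms] complex_Re_le_cmod order_trans by blast
  ultimately show "(ip_norm ip (\<lambda>x. f x + g x))\<^sup>2 \<le> (ip_norm ip f + ip_norm ip g)\<^sup>2"
    by (simp add: power2_sum)
qed (use assms norm_nonneg in auto)

lemma norm_scale:
  assumes "f \<in> H" shows "ip_norm ip (\<lambda>x. c * f x) = cmod c * ip_norm ip f"
proof (rule power2_eq_imp_eq)
  have "ip (\<lambda>x. c * f x) (\<lambda>x. c * f x) = c * cnj c * ip f f"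
    using assms by (simp add: scale_left scale_right scale_mem)
  then show "(ip_norm ip (\<lambda>x. c * f x))\<^sup>2 = (cmod c * ip_norm ip f)\<^sup>2"
    using assms ip_self[OF assms]
    by (subst norm_sq) (simp_all add: scale_mem complex_mult_cnj cmod_def power_mult_distrib)
qed (use assms norm_nonneg scale_mem in auto)

lemma norm_diff_triangle:
  assumes "f \<in> H" "g \<in> H" "h \<in> H"
  shows "ip_norm ip (\<lambda>x. f x - h x) \<le> ip_norm ip (\<lambda>x. f x - g x) + ip_norm ip (\<lambda>x. g x - h x)"
  using norm_triangle[of "\<lambda>x. f x - g x" "\<lambda>x. g x - h x"] assms by (simp add: diff_mem)

lemma norm_diff_commute:
  assumes "f \<in> H" "g \<in> H"
  shows "ip_norm ip (\<lambda>x. f x - g x) = ip_norm ip (\<lambda>x. g x - f x)"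
  using norm_scale[of "\<lambda>x. f x - g x" "-1"] assms by (simp add: diff_mem)

text \<open>
  A sequence in \<open>V\<close> that minimises the distance to \<open>g\<close> is a Cauchy sequence by the parallelogram law,
  and a point at minimal distance leaves a residual orthogonal to \<open>V\<close>.
\<close>

lemma projection_exists:
  assumes V: "V \<subseteq> H" "fun_subspace V" and g: "g \<in> H"
    and complete: "ip_complete V ip"
  shows "\<exists>p\<in>V. \<forall>h\<in>V. ip (\<lambda>x. g x - p x) h = 0"
proof -
  let ?N = "\<lambda>h. ip_norm ip (\<lambda>x. g x - h x)"
  define d where "d = Inf ((\<lambda>h. (?N h)\<^sup>2) ` V)"
  have ne: "V \<noteq> {}" using V by (auto simp: fun_subspace_def)
  have Vadd: "\<And>a b. \<lbrakk>a \<in> V; b \<in> V\<rbrakk> \<Longrightarrow> (\<lambda>x. a x + b x) \<in> V"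
    and Vscale: "\<And>a c. a \<in> V \<Longrightarrow> (\<lambda>x. c * a x) \<in> V"
    using V(2) by (auto simp: fun_subspace_def)
  have bdd: "bdd_below ((\<lambda>h. (?N h)\<^sup>2) ` V)" by (rule bdd_belowI[of _ 0]) auto
  have d_le: "d \<le> (?N h)\<^sup>2" if "h \<in> V" for h
    unfolding d_def using bdd that by (intro cInf_lower) auto
  have "\<exists>h\<in>V. (?N h)\<^sup>2 < d + 1 / (real n + 1)" for n
  proof -
    have "d < d + 1 / (real n + 1)" by simp
    then show ?thesis
      unfolding d_def using cInf_lessD[of "(\<lambda>h. (?N h)\<^sup>2) ` V"] ne by blast
  qed
  then obtain s where s: "\<And>n. s n \<in> V" "\<And>n. (?N (s n))\<^sup>2 < d + 1 / (real n + 1)"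
    by metis
  have sH: "s n \<in> H" for n using s V by auto
  have par: "(ip_norm ip (\<lambda>x. s m x - s n x))\<^sup>2 \<le> 2 / (real m + 1) + 2 / (real n + 1)" for m n
  proof -
    let ?a = "\<lambda>x. g x - s m x" and ?b = "\<lambda>x. g x - s n x"
    \<comment> \<open>The midpoint lies in \<open>V\<close> and so is no closer to \<open>g\<close> than the minimal distance.\<close>
    let ?mid = "\<lambda>x. (1/2) * (s m x + s n x)"
    have ab: "?a \<in> H" "?b \<in> H" using g sH diff_mem by auto
    have "?mid \<in> V" by (intro Vscale Vadd s(1))
    then have "d \<le> (?N ?mid)\<^sup>2" by (rule d_le)
    also have "(\<lambda>x. g x - ?mid x) = (\<lambda>x. (1/2) * (?a x + 1 * ?b x))" by (auto simp: field_simps)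
    finally have "4 * d \<le> (ip_norm ip (\<lambda>x. ?a x + 1 * ?b x))\<^sup>2"
      using norm_scale[of "\<lambda>x. ?a x + 1 * ?b x" "1/2"] scale_mem[OF ab(2), of 1] add_mem[OF ab(1)]
      by (subst (asm) norm_scale) (simp_all only: power_mult_distrib norm_divide norm_one norm_numeral, simp_all add: power_divide)
    moreover have "(\<lambda>x. ?b x + (-1) * ?a x) = (\<lambda>x. s m x - s n x)" by auto
    then have "(ip_norm ip (\<lambda>x. s m x - s n x))\<^sup>2 = (ip_norm ip ?b)\<^sup>2 - 2 * Re (ip ?b ?a) + (ip_norm ip ?a)\<^sup>2"
      using norm_sq_add_scale[OF ab(2,1), of "-1"] by simp
    moreover have "(ip_norm ip (\<lambda>x. ?a x + 1 * ?b x))\<^sup>2 = (ip_norm ip ?a)\<^sup>2 + 2 * Re (ip ?a ?b) + (ip_norm ip ?b)\<^sup>2"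
      using norm_sq_add_scale[OF ab, of 1] by simp
    moreover have "Re (ip ?b ?a) = Re (ip ?a ?b)" using hermitian[OF ab] by simp
    ultimately show ?thesis using s(2)[of m] s(2)[of n] by linarith
  qed
  have cau: "\<exists>M. \<forall>m\<ge>M. \<forall>n\<ge>M. ip_norm ip (\<lambda>x. s m x - s n x) < e" if "e > 0" for e
  proof -
    obtain M :: nat where M: "4 / e\<^sup>2 < real M" using reals_Archimedean2 by blast
    have "ip_norm ip (\<lambda>x. s m x - s n x) < e" if "m \<ge> M" "n \<ge> M" for m n
    proof -
      have Mp: "real M > 0" using M \<open>e > 0\<close> by (smt (verit) divide_pos_pos zero_less_power)
      have "2 / (real m + 1) \<le> 2 / (real M + 1)" "2 / (real n + 1) \<le> 2 / (real M + 1)"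
        using that Mp by (auto intro!: divide_left_mono)
      then have "(ip_norm ip (\<lambda>x. s m x - s n x))\<^sup>2 \<le> 4 / (real M + 1)" using par[of m n] by auto
      also have "\<dots> < e\<^sup>2" using M Mp \<open>e > 0\<close> by (simp add: field_simps) (smt (verit) zero_less_power)
      finally show ?thesis using \<open>e > 0\<close> by (meson less_eq_real_def power2_less_imp_less)
    qed
    then show ?thesis by blast
  qed
  then obtain p where p: "p \<in> V" "(\<lambda>n. ip_norm ip (\<lambda>x. s n x - p x)) \<longlonglongrightarrow> 0"
    using complete s(1) unfolding ip_complete_def by blast
  have pH: "p \<in> H" using p V by auto
  have "(?N p)\<^sup>2 \<le> d"
  proof -
    have "?N p \<le> sqrt (d + 1 / (real n + 1)) + ip_norm ip (\<lambda>x. s n x - p x)" for n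
      using norm_diff_triangle[OF g sH[of n] pH] s(2)[of n] real_le_rsqrt[of "?N (s n)" "d + 1 / (real n + 1)"]
      by linarith
    moreover have "(\<lambda>n. sqrt (d + 1 / (real n + 1)) + ip_norm ip (\<lambda>x. s n x - p x)) \<longlonglongrightarrow> sqrt (d + 0) + 0"
      by (intro tendsto_intros p(2) LIMSEQ_inverse_real_of_nat[unfolded inverse_eq_divide of_nat_Suc add.commute[of 1]])
    ultimately have "?N p \<le> sqrt d" by (intro LIMSEQ_le_const[of _ "sqrt d"]) auto
    moreover have "0 \<le> d" unfolding d_def using ne by (intro cInf_greatest) auto
    ultimately show ?thesis
      using norm_nonneg[OF diff_mem[OF g pH]] by (metis power_mono real_sqrt_pow2)
  qed
  then have min: "(?N p)\<^sup>2 \<le> (?N h)\<^sup>2" if "h \<in> V" for h using d_le[OF that] by linarith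
  have "ip (\<lambda>x. g x - p x) h = 0" if h: "h \<in> V" for h
  proof (rule ortho_of_minimal)
    fix c
    have q: "(\<lambda>x. p x + (-c) * h x) \<in> V"
      by (intro Vadd Vscale p(1) h)
    have e: "(\<lambda>x. g x - (p x + (-c) * h x)) = (\<lambda>x. g x - p x + c * h x)" by auto
    show "(?N p)\<^sup>2 \<le> (ip_norm ip (\<lambda>x. g x - p x + c * h x))\<^sup>2"
      using min[OF q] unfolding e .
  qed (use g pH h V diff_mem in auto)
  with p show ?thesis by blast
qed

lemma annihilator_closed:
  assumes "S \<subseteq> H"
  shows "closed_subspace H ip {f \<in> H. \<forall>z\<in>S. ip f z = 0}"
  unfolding closed_subspace_def
proof (intro conjI allI impI)
  have zero: "(\<lambda>x. 0) \<in> H" using subspace by (simp add: fun_subspace_def)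
  have "ip (\<lambda>x. 0) z = 0" if "z \<in> H" for z
    using scale_left[OF zero that, of 0] by simp
  then show "fun_subspace {f \<in> H. \<forall>z\<in>S. ip f z = 0}"
    unfolding fun_subspace_def using assms zero
    by (auto simp: add_mem scale_mem add_left scale_left subset_iff)
  fix s :: "nat \<Rightarrow> 'b \<Rightarrow> complex" and l
  assume a: "(\<forall>n. s n \<in> {f \<in> H. \<forall>z\<in>S. ip f z = 0}) \<and> l \<in> H \<and> (\<lambda>n. ip_norm ip (\<lambda>x. s n x - l x)) \<longlonglongrightarrow> 0"
  have "ip l z = 0" if z: "z \<in> S" for z
  proof -
    have zH: "z \<in> H" using z assms by auto
    have "cmod (ip l z) \<le> ip_norm ip (\<lambda>x. s n x - l x) * ip_norm ip z" for n
      using cauchy_schwarz[OF diff_mem[of "s n" l] zH] diff_left[of "s n" l z] a z zH by simp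
    moreover have "(\<lambda>n. ip_norm ip (\<lambda>x. s n x - l x) * ip_norm ip z) \<longlonglongrightarrow> 0 * ip_norm ip z"
      using a by (intro tendsto_intros) auto
    ultimately have "cmod (ip l z) \<le> 0" by (intro LIMSEQ_le_const[of _ 0]) auto
    then show ?thesis by simp
  qed
  then show "l \<in> {f \<in> H. \<forall>z\<in>S. ip f z = 0}" using a by auto
qed auto

lemma orth_projector_exists:
  assumes V: "closed_subspace H ip V" and complete: "ip_complete H ip"
  shows "\<exists>P. orth_projector H ip V P"
proof -
  have VH: "V \<subseteq> H" "fun_subspace V"
    and cl: "\<And>s l. \<lbrakk>\<And>n. s n \<in> V; l \<in> H; (\<lambda>n. ip_norm ip (\<lambda>x. s n x - l x)) \<longlonglongrightarrow> 0\<rbrakk> \<Longrightarrow> l \<in> V"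
    using V unfolding closed_subspace_def by blast+
  have "ip_complete V ip"
    unfolding ip_complete_def
  proof (intro allI impI)
    fix s :: "nat \<Rightarrow> 'b \<Rightarrow> complex"
    assume s: "(\<forall>n. s n \<in> V) \<and> (\<forall>e>0. \<exists>N. \<forall>m\<ge>N. \<forall>n\<ge>N. ip_norm ip (\<lambda>x. s m x - s n x) < e)"
    have "\<forall>n. s n \<in> H" using s VH(1) by auto
    with complete[unfolded ip_complete_def, rule_format, of s] s
    obtain l where "l \<in> H" "(\<lambda>n. ip_norm ip (\<lambda>x. s n x - l x)) \<longlonglongrightarrow> 0"
      by auto
    then show "\<exists>l\<in>V. (\<lambda>n. ip_norm ip (\<lambda>x. s n x - l x)) \<longlonglongrightarrow> 0" using cl s by blast
  qed
  then have "\<forall>g\<in>H. \<exists>p. p \<in> V \<and> (\<forall>h\<in>V. ip (\<lambda>x. g x - p x) h = 0)"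
    using projection_exists[OF VH] by blast
  from bchoice[OF this] show ?thesis unfolding orth_projector_def .
qed

end

section \<open>Square integrable functions\<close>

lemma L2_on_UNIV_iff:
  "L2_on UNIV f \<longleftrightarrow> f \<in> borel_measurable borel \<and> integrable lborel (\<lambda>x. (cmod (f x))\<^sup>2)"
  by (simp add: L2_on_def set_borel_measurable_def set_integrable_def)

lemma L2_norm_UNIV: "L2_norm_on UNIV f = sqrt (LINT x|lborel. (cmod (f x))\<^sup>2)"
  by (simp add: L2_norm_on_def set_lebesgue_integral_def)

lemma L2_norm_nonneg: "0 \<le> L2_norm_on S f"
  by (simp add: L2_norm_on_def set_lebesgue_integral_def)

lemma L2_measurable [measurable_dest]: "L2_on UNIV f \<Longrightarrow> f \<in> borel_measurable borel"
  by (simp add: L2_on_UNIV_iff)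

lemma L2_square_integrable: "L2_on UNIV f \<Longrightarrow> integrable lborel (\<lambda>x. (cmod (f x))\<^sup>2)"
  by (simp add: L2_on_UNIV_iff)

lemma L2_norm_sq: "(L2_norm_on UNIV f)\<^sup>2 = (LINT x|lborel. (cmod (f x))\<^sup>2)"
  by (simp add: L2_norm_UNIV)

lemma L2_norm_cong_AE:
  assumes "AE x in lborel. f x = g x" "f \<in> borel_measurable borel" "g \<in> borel_measurable borel"
  shows "L2_norm_on UNIV f = L2_norm_on UNIV g"
  unfolding L2_norm_UNIV using assms by (auto intro!: integral_cong_AE arg_cong[where f=sqrt])

lemma nn_integral_L2:
  assumes "L2_on UNIV f"
  shows "(\<integral>\<^sup>+x. ennreal ((cmod (f x))\<^sup>2) \<partial>lborel) = ennreal ((L2_norm_on UNIV f)\<^sup>2)"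
  using assms by (simp add: L2_norm_sq nn_integral_eq_integral L2_square_integrable)

lemma L2_I_nn_integral:
  assumes [measurable]: "f \<in> borel_measurable borel"
    and "(\<integral>\<^sup>+x. ennreal ((cmod (f x))\<^sup>2) \<partial>lborel) \<le> ennreal (C\<^sup>2)" "0 \<le> C"
  shows "L2_on UNIV f" "L2_norm_on UNIV f \<le> C"
proof -
  have "(\<integral>\<^sup>+x. ennreal ((cmod (f x))\<^sup>2) \<partial>lborel) < \<infinity>"
    using assms(2) by (rule order_le_less_trans) simp
  then show L: "L2_on UNIV f"
    unfolding L2_on_UNIV_iff by (auto intro!: integrableI_bounded)
  have "(L2_norm_on UNIV f)\<^sup>2 \<le> C\<^sup>2"
    using assms(2) unfolding nn_integral_L2[OF L] by simp
  then show "L2_norm_on UNIV f \<le> C" using assms(3) by (rule power2_le_imp_le)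
qed

lemma L2_bounded_mult:
  assumes "L2_on UNIV f" and [measurable]: "u \<in> borel_measurable borel"
    and "\<And>x. cmod (u x) \<le> C"
  shows "L2_on UNIV (\<lambda>x. u x * f x)" "L2_norm_on UNIV (\<lambda>x. u x * f x) \<le> C * L2_norm_on UNIV f"
proof -
  have C: "0 \<le> C" using assms(3)[of undefined] norm_ge_zero order_trans by blast
  note [measurable] = L2_measurable[OF assms(1)]
  have "(\<integral>\<^sup>+x. ennreal ((cmod (u x * f x))\<^sup>2) \<partial>lborel)
      \<le> (\<integral>\<^sup>+x. ennreal (C\<^sup>2) * ennreal ((cmod (f x))\<^sup>2) \<partial>lborel)"
    using assms(3) C
    by (intro nn_integral_mono)
      (auto simp: norm_mult power_mult_distrib ennreal_mult'[symmetric] intro!: ennreal_leI mult_right_mono power_mono)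
  also have "\<dots> = ennreal ((C * L2_norm_on UNIV f)\<^sup>2)"
    by (simp add: nn_integral_cmult nn_integral_L2 assms(1) power_mult_distrib ennreal_mult)
  finally have *: "(\<integral>\<^sup>+x. ennreal ((cmod (u x * f x))\<^sup>2) \<partial>lborel) \<le> ennreal ((C * L2_norm_on UNIV f)\<^sup>2)" .
  show "L2_on UNIV (\<lambda>x. u x * f x)"
    by (rule L2_I_nn_integral[OF _ *]) (simp_all add: C L2_norm_nonneg)
  show "L2_norm_on UNIV (\<lambda>x. u x * f x) \<le> C * L2_norm_on UNIV f"
    by (rule L2_I_nn_integral[OF _ *]) (simp_all add: C L2_norm_nonneg)
qed

lemma L2_add:
  assumes "L2_on UNIV f" "L2_on UNIV g" shows "L2_on UNIV (\<lambda>x. f x + g x)"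
proof -
  note [measurable] = L2_measurable[OF assms(1)] L2_measurable[OF assms(2)]
  have "integrable lborel (\<lambda>x. 2 * (cmod (f x))\<^sup>2 + 2 * (cmod (g x))\<^sup>2)"
    using assms by (intro Bochner_Integration.integrable_add integrable_mult_right L2_square_integrable)
  then have "integrable lborel (\<lambda>x. (cmod (f x + g x))\<^sup>2)"
  proof (rule Bochner_Integration.integrable_bound)
    have "(cmod (a + b))\<^sup>2 \<le> 2 * (cmod a)\<^sup>2 + 2 * (cmod b)\<^sup>2" for a b :: complex
    proof -
      have "(cmod (a + b))\<^sup>2 \<le> (cmod a + cmod b)\<^sup>2" by (simp add: norm_triangle_ineq power_mono)
      also have "\<dots> \<le> 2 * (cmod a)\<^sup>2 + 2 * (cmod b)\<^sup>2"
        using sum_squares_bound[of "cmod a" "cmod b"] by (simp add: power2_sum)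
      finally show ?thesis .
    qed
    then show "AE x in lborel. norm ((cmod (f x + g x))\<^sup>2) \<le> norm (2 * (cmod (f x))\<^sup>2 + 2 * (cmod (g x))\<^sup>2)"
      by auto
  qed simp
  then show ?thesis by (simp add: L2_on_UNIV_iff)
qed

lemma L2_scale: "L2_on UNIV f \<Longrightarrow> L2_on UNIV (\<lambda>x. c * f x)"
  using L2_bounded_mult(1)[of f "\<lambda>_. c" "cmod c"] by simp

lemma borel_measurable_cnj [measurable]: "cnj \<in> borel_measurable borel"
  by (intro borel_measurable_continuous_onI continuous_intros)

lemma L2_cnj: "L2_on UNIV f \<Longrightarrow> L2_on UNIV (\<lambda>x. cnj (f x))"
  unfolding L2_on_UNIV_iff by (auto intro: measurable_compose[OF _ borel_measurable_cnj])

lemma L2_mult_integrable: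
  assumes "L2_on UNIV f" "L2_on UNIV g" shows "integrable lborel (\<lambda>x. f x * g x)"
proof (rule Bochner_Integration.integrable_bound)
  note [measurable] = L2_measurable[OF assms(1)] L2_measurable[OF assms(2)]
  show "integrable lborel (\<lambda>x. (cmod (f x))\<^sup>2 + (cmod (g x))\<^sup>2)"
    using assms by (intro Bochner_Integration.integrable_add L2_square_integrable)
  have "a * b \<le> a\<^sup>2 + b\<^sup>2" if "0 \<le> a" "0 \<le> b" for a b :: real
    using sum_squares_bound[of a b] mult_nonneg_nonneg[OF that] by linarith
  then show "AE x in lborel. norm (f x * g x) \<le> norm ((cmod (f x))\<^sup>2 + (cmod (g x))\<^sup>2)"
    by (auto simp: norm_mult)
  show "(\<lambda>x. f x * g x) \<in> borel_measurable lborel" by simp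
qed

definition L2_ip :: "'a::euclidean_space inner_product" where
  "L2_ip f g = (LINT x|lborel. f x * cnj (g x))"

interpretation L2: semi_inner_product "Collect (L2_on UNIV)" L2_ip
proof
  show "fun_subspace (Collect (L2_on UNIV))"
    unfolding fun_subspace_def using L2_add L2_scale by (auto simp: L2_on_UNIV_iff)
  show "L2_ip g f = cnj (L2_ip f g)" for f g :: "'a \<Rightarrow> complex"
    unfolding L2_ip_def by (subst Bochner_Integration.integral_cnj[symmetric]) (simp add: mult.commute)
  show "L2_ip (\<lambda>x. f x + g x) h = L2_ip f h + L2_ip g h"
    if "f \<in> Collect (L2_on UNIV)" "g \<in> Collect (L2_on UNIV)" "h \<in> Collect (L2_on UNIV)"
    for f g h :: "'a \<Rightarrow> complex"
    unfolding L2_ip_def distrib_right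
    using that by (intro Bochner_Integration.integral_add L2_mult_integrable L2_cnj) auto
  show "L2_ip (\<lambda>x. c * f x) h = c * L2_ip f h"
    if "f \<in> Collect (L2_on UNIV)" "h \<in> Collect (L2_on UNIV)" for f h :: "'a \<Rightarrow> complex" and c
    unfolding L2_ip_def mult.assoc by simp
  show "0 \<le> Re (L2_ip f f)" for f :: "'a \<Rightarrow> complex"
    unfolding L2_ip_def complex_norm_square[symmetric] by (simp del: of_real_power)
qed

lemma L2_ip_norm: "ip_norm L2_ip f = L2_norm_on UNIV f"
  unfolding ip_norm_def L2_ip_def L2_norm_UNIV complex_norm_square[symmetric]
  by (simp del: of_real_power)

lemmas L2_diff = L2.diff_mem[unfolded mem_Collect_eq]
  and L2_cauchy_schwarz = L2.cauchy_schwarz[unfolded mem_Collect_eq L2_ip_norm]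
  and L2_norm_triangle = L2.norm_triangle[unfolded mem_Collect_eq L2_ip_norm]
  and L2_norm_diff_triangle = L2.norm_diff_triangle[unfolded mem_Collect_eq L2_ip_norm]
  and L2_norm_diff_commute = L2.norm_diff_commute[unfolded mem_Collect_eq L2_ip_norm]

lemma L2_norm_cnj: "L2_norm_on UNIV (\<lambda>x. cnj (f x)) = L2_norm_on UNIV f"
  by (simp add: L2_norm_UNIV)

lemma L2_norm_zero_AE:
  assumes "L2_on UNIV f" "L2_norm_on UNIV f = 0"
  shows "AE x in lborel. f x = 0"
proof -
  have "(LINT x|lborel. (cmod (f x))\<^sup>2) = 0" using assms(2) by (simp add: L2_norm_UNIV)
  then show ?thesis
    using integral_nonneg_eq_0_iff_AE[OF L2_square_integrable[OF assms(1)]] by simp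
qed

text \<open>
  Fatou's lemma in the form used below: norm bounds survive pointwise limits.
\<close>

lemma L2_fatou:
  assumes "\<And>n. L2_on UNIV (g n)" "eventually (\<lambda>n. L2_norm_on UNIV (g n) \<le> C) sequentially"
    and "AE x in lborel. (\<lambda>n. g n x) \<longlonglongrightarrow> h x" and [measurable]: "h \<in> borel_measurable borel"
  shows "L2_on UNIV h" "L2_norm_on UNIV h \<le> C"
proof -
  note [measurable] = L2_measurable[OF assms(1)]
  have C: "0 \<le> C" using assms(2) L2_norm_nonneg
    by (metis (mono_tags, lifting) eventually_sequentially order_refl order_trans)
  have "(\<integral>\<^sup>+x. ennreal ((cmod (h x))\<^sup>2) \<partial>lborel) = (\<integral>\<^sup>+x. liminf (\<lambda>n. ennreal ((cmod (g n x))\<^sup>2)) \<partial>lborel)"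
  proof (rule nn_integral_cong_AE, use assms(3) in eventually_elim)
    fix x assume "(\<lambda>n. g n x) \<longlonglongrightarrow> h x"
    then have "(\<lambda>n. ennreal ((cmod (g n x))\<^sup>2)) \<longlonglongrightarrow> ennreal ((cmod (h x))\<^sup>2)"
      by (intro tendsto_intros)
    from lim_imp_Liminf[OF trivial_limit_sequentially this]
    show "ennreal ((cmod (h x))\<^sup>2) = liminf (\<lambda>n. ennreal ((cmod (g n x))\<^sup>2))" ..
  qed
  also have "\<dots> \<le> liminf (\<lambda>n. \<integral>\<^sup>+x. ennreal ((cmod (g n x))\<^sup>2) \<partial>lborel)"
    by (intro nn_integral_liminf) simp
  also have "\<dots> = liminf (\<lambda>n. ennreal ((L2_norm_on UNIV (g n))\<^sup>2))"
    by (simp add: nn_integral_L2 assms(1))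
  also have "\<dots> \<le> liminf (\<lambda>n. ennreal (C\<^sup>2))"
    using assms(2) L2_norm_nonneg
    by (intro Liminf_mono, elim eventually_mono) (auto intro!: ennreal_leI power_mono)
  also have "\<dots> = ennreal (C\<^sup>2)" by (simp add: Liminf_const)
  finally have *: "(\<integral>\<^sup>+x. ennreal ((cmod (h x))\<^sup>2) \<partial>lborel) \<le> ennreal (C\<^sup>2)" .
  show "L2_on UNIV h" "L2_norm_on UNIV h \<le> C"
    using L2_I_nn_integral[OF _ * C] by simp_all
qed

lemma L2_norm_on_cong: "(\<And>x. x \<in> S \<Longrightarrow> f x = g x) \<Longrightarrow> L2_norm_on S f = L2_norm_on S g"
  unfolding L2_norm_on_def set_lebesgue_integral_def
  by (intro arg_cong[where f=sqrt] Bochner_Integration.integral_cong) (auto simp: indicator_def)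

lemma L2_norm_on_scale: "L2_norm_on S (\<lambda>x. c * f x) = cmod c * L2_norm_on S f"
proof -
  have "L2_norm_on S (\<lambda>x. c * f x) = sqrt ((cmod c)\<^sup>2 * (LINT x:S|lborel. (cmod (f x))\<^sup>2))"
    unfolding L2_norm_on_def set_lebesgue_integral_def
    by (subst integral_mult_right_zero[symmetric]) (simp add: norm_mult power_mult_distrib mult_ac)
  then show ?thesis by (simp add: real_sqrt_mult L2_norm_on_def)
qed

lemma L2_norm_on_eq_UNIV: "L2_norm_on S f = L2_norm_on UNIV (\<lambda>x. of_real (indicator S x) * f x)"
  unfolding L2_norm_on_def set_lebesgue_integral_def
  by (intro arg_cong[where f=sqrt] Bochner_Integration.integral_cong) (auto simp: indicator_def)

lemma L2_restrict:
  assumes "L2_on UNIV f" and [measurable]: "S \<in> sets borel"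
  shows "L2_on UNIV (\<lambda>x. of_real (indicator S x) * f x)" and "L2_norm_on S f \<le> L2_norm_on UNIV f"
  unfolding L2_norm_on_eq_UNIV[of S f]
  using L2_bounded_mult[OF assms(1), of "\<lambda>x. of_real (indicator S x)" 1] by (auto simp: indicator_def)

text \<open>
  The Riesz--Fischer argument. Along a subsequence with differences of norm at most $2^{-k}$, the
  series of the squares of the differences converges almost everywhere even with weights $(3/2)^k$, and this
  dominates the differences themselves up to the summable sequence $(2/3)^k$.
\<close>

lemma L2_complete:
  fixes s :: "nat \<Rightarrow> 'a::euclidean_space \<Rightarrow> complex"
  assumes s: "\<And>n. L2_on UNIV (s n)"
    and cauchy: "\<And>e. 0 < e \<Longrightarrow> \<exists>N. \<forall>m\<ge>N. \<forall>n\<ge>N. L2_norm_on UNIV (\<lambda>x. s m x - s n x) < e"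
  shows "\<exists>l. L2_on UNIV l \<and> (\<lambda>n. L2_norm_on UNIV (\<lambda>x. s n x - l x)) \<longlonglongrightarrow> 0"
proof -
  note [measurable] = L2_measurable[OF s]
  have "\<exists>N. \<forall>m\<ge>N. \<forall>n\<ge>N. L2_norm_on UNIV (\<lambda>x. s m x - s n x) < (1/2)^k" for k :: nat
    by (rule cauchy) simp
  then obtain N where N: "\<And>k m n. m \<ge> N k \<Longrightarrow> n \<ge> N k \<Longrightarrow> L2_norm_on UNIV (\<lambda>x. s m x - s n x) < (1/2)^k"
    by metis
  \<comment> \<open>The summand \<open>k\<close> makes \<open>r\<close> unbounded, the sum makes it monotone and at least \<open>N k\<close>.\<close>
  define r where "r k = k + (\<Sum>i\<le>k. N i)" for k
  have r_N: "N k \<le> r k" for k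
    unfolding r_def by (simp add: trans_le_add2 member_le_sum)
  have r_mono: "mono r" unfolding r_def by (intro monoI add_mono sum_mono2) auto
  have r_ge: "k \<le> r k" for k by (simp add: r_def)
  let ?d = "\<lambda>k x. s (r (Suc k)) x - s (r k) x"
  have dL: "L2_on UNIV (?d k)" for k using s L2_diff by blast
  have d_le: "L2_norm_on UNIV (?d k) \<le> (1/2)^k" for k
    using N[OF order_trans[OF r_N monoD[OF r_mono]] r_N, of k "Suc k"] by simp
  have "(\<integral>\<^sup>+x. (\<Sum>k. ennreal ((3/2)^k * (cmod (?d k x))\<^sup>2)) \<partial>lborel)
     = (\<Sum>k. \<integral>\<^sup>+x. ennreal ((3/2)^k) * ennreal ((cmod (?d k x))\<^sup>2) \<partial>lborel)"
    by (subst nn_integral_suminf) (auto simp: ennreal_mult)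
  also have "\<dots> = (\<Sum>k. ennreal ((3/2)^k * (L2_norm_on UNIV (?d k))\<^sup>2))"
    using dL by (subst nn_integral_cmult) (auto simp: nn_integral_L2 ennreal_mult)
  also have "\<dots> \<le> (\<Sum>k. ennreal ((3/8)^k))"
  proof (intro suminf_le ennreal_leI)
    fix k
    have "(L2_norm_on UNIV (?d k))\<^sup>2 \<le> ((1/2)^k)\<^sup>2"
      using d_le L2_norm_nonneg by (intro power_mono)
    then have "(3/2)^k * (L2_norm_on UNIV (?d k))\<^sup>2 \<le> (3/2)^k * ((1/2)^k)\<^sup>2" by simp
    also have "\<dots> = ((3/2) * ((1/2) * (1/2)))^k"
      by (simp only: power_mult_distrib power2_eq_square)
    finally show "(3/2)^k * (L2_norm_on UNIV (?d k))\<^sup>2 \<le> (3/8)^k" by simp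
  qed auto
  also have "\<dots> = ennreal (\<Sum>k. (3/8)^k)" by (intro suminf_ennreal2 summable_geometric) auto
  also have "\<dots> < \<infinity>" by simp
  finally have "AE x in lborel. (\<Sum>k. ennreal ((3/2)^k * (cmod (?d k x))\<^sup>2)) \<noteq> \<infinity>"
    by (intro nn_integral_PInf_AE) auto
  then have conv: "AE x in lborel. convergent (\<lambda>k. s (r k) x)"
  proof eventually_elim
    fix x assume "(\<Sum>k. ennreal ((3/2)^k * (cmod (?d k x))\<^sup>2)) \<noteq> \<infinity>"
    then have "summable (\<lambda>k. (3/2)^k * (cmod (?d k x))\<^sup>2)"
      by (intro summable_suminf_not_top) auto
    then have "summable (\<lambda>k. (2/3)^k + (3/2)^k * (cmod (?d k x))\<^sup>2)"
      by (intro summable_add summable_geometric) auto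
    then have "summable (\<lambda>k. ?d k x)"
    proof (rule summable_comparison_test')
      fix k :: nat assume "k \<ge> 0"
      let ?c = "(3/2::real)^k" and ?n = "cmod (?d k x)"
      have c: "(2/3::real)^k * ?c = 1" by (simp flip: power_mult_distrib)
      show "?n \<le> (2/3)^k + ?c * ?n\<^sup>2"
      proof (cases "?n \<le> (2/3)^k")
        case True then show ?thesis by (simp add: add_increasing2)
      next
        case False
        then have "(2/3)^k * (?c * ?n) \<le> ?n * (?c * ?n)" by (intro mult_right_mono) auto
        moreover have "(2/3)^k * (?c * ?n) = ?n"
          unfolding mult.assoc[symmetric] c by (rule mult_1_left)
        ultimately have "?n \<le> ?c * ?n\<^sup>2"
          by (simp only: power2_eq_square mult.left_commute)
        then show ?thesis by (simp add: add_increasing)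
      qed
    qed
    then have "convergent (\<lambda>n. \<Sum>k<n. ?d k x)" by (simp add: summable_iff_convergent)
    then have "convergent (\<lambda>n. s (r n) x - s (r 0) x)"
      using sum_lessThan_telescope[of "\<lambda>k. s (r k) x"] by simp
    then show "convergent (\<lambda>n. s (r n) x)" by (simp add: convergent_diff_const_right_iff)
  qed
  define l where "l x = lim (\<lambda>k. s (r k) x)" for x
  have [measurable]: "l \<in> borel_measurable borel"
    unfolding l_def by (intro borel_measurable_lim_metric) simp
  have lim: "AE x in lborel. (\<lambda>k. s (r k) x) \<longlonglongrightarrow> l x"
    using conv by eventually_elim (simp add: l_def convergent_LIMSEQ_iff)
  have close: "L2_on UNIV (\<lambda>x. l x - s n x) \<and> L2_norm_on UNIV (\<lambda>x. l x - s n x) \<le> e"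
    if e: "\<forall>m\<ge>M. \<forall>n\<ge>M. L2_norm_on UNIV (\<lambda>x. s m x - s n x) < e" and n: "n \<ge> M" for e M n
  proof -
    have a: "\<And>k. L2_on UNIV (\<lambda>x. s (r k) x - s n x)" using s L2_diff by blast
    have b: "eventually (\<lambda>k. L2_norm_on UNIV (\<lambda>x. s (r k) x - s n x) \<le> e) sequentially"
      using eventually_ge_at_top[of M]
    proof eventually_elim
      case (elim k)
      then show ?case using e n r_ge[of k] by (meson less_imp_le order_trans)
    qed
    have c: "AE x in lborel. (\<lambda>k. s (r k) x - s n x) \<longlonglongrightarrow> l x - s n x"
      using lim by eventually_elim (intro tendsto_intros)
    show ?thesis using L2_fatou[OF a b c] by simp
  qed
  obtain M0 where "\<forall>m\<ge>M0. \<forall>n\<ge>M0. L2_norm_on UNIV (\<lambda>x. s m x - s n x) < 1"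
    using cauchy[of 1] by auto
  then have "L2_on UNIV (\<lambda>x. l x - s M0 x)" using close by blast
  then have lL: "L2_on UNIV l" using L2_add[OF _ s[of M0], of "\<lambda>x. l x - s M0 x"] by simp
  have "(\<lambda>n. L2_norm_on UNIV (\<lambda>x. s n x - l x)) \<longlonglongrightarrow> 0"
  proof (rule LIMSEQ_I)
    fix e :: real assume "e > 0"
    then obtain M where M: "\<forall>m\<ge>M. \<forall>n\<ge>M. L2_norm_on UNIV (\<lambda>x. s m x - s n x) < e/2"
      using cauchy[of "e/2"] by auto
    have "norm (L2_norm_on UNIV (\<lambda>x. s n x - l x) - 0) < e" if "n \<ge> M" for n
      using close[OF M that] L2_norm_diff_commute[OF s[of n] lL] \<open>e > 0\<close> L2_norm_nonneg[of UNIV "\<lambda>x. s n x - l x"]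
      by simp
    then show "\<exists>no. \<forall>n\<ge>no. norm (L2_norm_on UNIV (\<lambda>x. s n x - l x) - 0) < e" by blast
  qed
  with lL show ?thesis by blast
qed

lemma L2_limit_unique:
  assumes "L2_on UNIV \<phi>" "L2_on UNIV \<psi>" "\<And>n. L2_on UNIV (g n)"
    and "(\<lambda>n. L2_norm_on UNIV (\<lambda>x. \<phi> x - g n x)) \<longlonglongrightarrow> 0"
    and "(\<lambda>n. L2_norm_on UNIV (\<lambda>x. \<psi> x - g n x)) \<longlonglongrightarrow> 0"
  shows "AE x in lborel. \<phi> x = \<psi> x"
proof -
  have "L2_norm_on UNIV (\<lambda>x. \<phi> x - \<psi> x) \<le>
    L2_norm_on UNIV (\<lambda>x. \<phi> x - g n x) + L2_norm_on UNIV (\<lambda>x. \<psi> x - g n x)" for n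
    using L2_norm_diff_triangle[OF assms(1,3,2), of n] L2_norm_diff_commute[OF assms(2,3), of n] by simp
  moreover have "(\<lambda>n. L2_norm_on UNIV (\<lambda>x. \<phi> x - g n x) + L2_norm_on UNIV (\<lambda>x. \<psi> x - g n x)) \<longlonglongrightarrow> 0 + 0"
    by (intro tendsto_add assms)
  ultimately have "L2_norm_on UNIV (\<lambda>x. \<phi> x - \<psi> x) \<le> 0"
    by (intro LIMSEQ_le_const[of _ 0]) auto
  then have "L2_norm_on UNIV (\<lambda>x. \<phi> x - \<psi> x) = 0" using L2_norm_nonneg by (metis order_antisym)
  from L2_norm_zero_AE[OF L2_diff[OF assms(1,2)] this] show ?thesis by auto
qed

text \<open>
  The Fourier transform is symmetric for the bilinear pairing $\int f g$ rather than for the inner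
  product, so the Cauchy--Schwarz inequality and its consequences are needed in bilinear form.
\<close>

lemma L2_pairing_bound:
  assumes "L2_on UNIV f" "L2_on UNIV g"
  shows "cmod (LINT x|lborel. f x * g x) \<le> L2_norm_on UNIV f * L2_norm_on UNIV g"
  using L2_cauchy_schwarz[OF assms(1) L2_cnj[OF assms(2)]] by (simp add: L2_ip_def L2_norm_cnj)

lemma L2_pairing_tendsto:
  assumes f: "L2_on UNIV f" "\<And>n. L2_on UNIV (f' n)" "(\<lambda>n. L2_norm_on UNIV (\<lambda>x. f x - f' n x)) \<longlonglongrightarrow> 0"
    and g: "L2_on UNIV g" "\<And>n. L2_on UNIV (g' n)" "(\<lambda>n. L2_norm_on UNIV (\<lambda>x. g x - g' n x)) \<longlonglongrightarrow> 0"
  shows "(\<lambda>n. LINT x|lborel. f' n x * g' n x) \<longlonglongrightarrow> (LINT x|lborel. f x * g x)"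
proof -
  let ?F = "\<lambda>n. L2_norm_on UNIV (\<lambda>x. f x - f' n x)" and ?G = "\<lambda>n. L2_norm_on UNIV (\<lambda>x. g x - g' n x)"
  have fd: "L2_on UNIV (\<lambda>x. f x - f' n x)" and gd: "L2_on UNIV (\<lambda>x. g x - g' n x)" for n
    using f g L2_diff by blast+
  have b: "cmod ((LINT x|lborel. f x * g x) - (LINT x|lborel. f' n x * g' n x))
     \<le> ?F n * L2_norm_on UNIV g + (L2_norm_on UNIV f + ?F n) * ?G n" for n
  proof -
    have "L2_norm_on UNIV (f' n) \<le> L2_norm_on UNIV f + ?F n"
      using L2_norm_triangle[OF f(1) L2_diff[OF f(2)[of n] f(1)]] L2_norm_diff_commute[OF f(1) f(2)[of n]]
      by simp
    then have n: "L2_norm_on UNIV (f' n) * ?G n \<le> (L2_norm_on UNIV f + ?F n) * ?G n"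
      by (intro mult_right_mono L2_norm_nonneg)
    have "(LINT x|lborel. f x * g x) - (LINT x|lborel. f' n x * g' n x) =
       (LINT x|lborel. f x * g x - f' n x * g' n x)"
      using f g by (intro Bochner_Integration.integral_diff[symmetric] L2_mult_integrable)
    also have "\<dots> = (LINT x|lborel. (f x - f' n x) * g x + f' n x * (g x - g' n x))"
      by (simp add: algebra_simps)
    also have "\<dots> = (LINT x|lborel. (f x - f' n x) * g x) + (LINT x|lborel. f' n x * (g x - g' n x))"
      using f(2) g(1) fd gd by (intro Bochner_Integration.integral_add L2_mult_integrable)
    also have "cmod \<dots> \<le> ?F n * L2_norm_on UNIV g + L2_norm_on UNIV (f' n) * ?G n"
      using f(2) g(1) fd gd by (intro norm_triangle_le add_mono L2_pairing_bound)
    finally show ?thesis using n by linarith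
  qed
  have "(\<lambda>n. ?F n * L2_norm_on UNIV g + (L2_norm_on UNIV f + ?F n) * ?G n)
     \<longlonglongrightarrow> 0 * L2_norm_on UNIV g + (L2_norm_on UNIV f + 0) * 0"
    by (intro tendsto_intros f g)
  then have "(\<lambda>n. ?F n * L2_norm_on UNIV g + (L2_norm_on UNIV f + ?F n) * ?G n) \<longlonglongrightarrow> 0" by simp
  then have "(\<lambda>n. (LINT x|lborel. f x * g x) - (LINT x|lborel. f' n x * g' n x)) \<longlonglongrightarrow> 0"
    by (rule Lim_null_comparison[rotated]) (use b in auto)
  from tendsto_diff[OF tendsto_const[of "LINT x|lborel. f x * g x"] this] show ?thesis by simp
qed

section \<open>Fourier integrals\<close>

lemma
  fixes g :: "'a::euclidean_space \<Rightarrow> 'b::{banach, second_countable_topology}"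
  assumes [measurable]: "g \<in> borel_measurable borel"
  shows integral_translate: "(LINT x|lborel. g (a + x)) = (LINT x|lborel. g x)"
    and integrable_translate: "integrable lborel (\<lambda>x. g (a + x)) \<longleftrightarrow> integrable lborel g"
proof -
  have "(LINT x|distr lborel borel ((+) a). g x) = (LINT x|lborel. g (a + x))"
    by (rule integral_distr) auto
  then show "(LINT x|lborel. g (a + x)) = (LINT x|lborel. g x)"
    unfolding lborel_distr_plus by simp
  have "integrable (distr lborel borel ((+) a)) g = integrable lborel (\<lambda>x. g (a + x))"
    by (rule integrable_distr_eq) auto
  then show "integrable lborel (\<lambda>x. g (a + x)) \<longleftrightarrow> integrable lborel g"
    unfolding lborel_distr_plus by simp
qed

lemma integral_affine:
  fixes g :: "'a::euclidean_space \<Rightarrow> 'b::{banach, second_countable_topology}"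
  assumes [measurable]: "g \<in> borel_measurable borel" and c: "c \<noteq> 0"
  shows "(LINT x|lborel. g x) = \<bar>c\<bar> ^ DIM('a) *\<^sub>R (LINT x|lborel. g (a + c *\<^sub>R x))"
proof -
  have "(LINT x|lborel. g x) =
    (LINT x|density (distr lborel borel (\<lambda>x. a + c *\<^sub>R x)) (\<lambda>_. ennreal (\<bar>c\<bar> ^ DIM('a))). g x)"
    using lborel_affine[OF c, of a] by simp
  also have "\<dots> = (LINT x|distr lborel borel (\<lambda>x. a + c *\<^sub>R x). \<bar>c\<bar> ^ DIM('a) *\<^sub>R g x)"
    by (rule integral_density) auto
  also have "\<dots> = (LINT x|lborel. \<bar>c\<bar> ^ DIM('a) *\<^sub>R g (a + c *\<^sub>R x))"
    by (rule integral_distr) auto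
  finally show ?thesis by simp
qed

lemma
  fixes f :: "'a::euclidean_space \<Rightarrow> real \<Rightarrow> complex"
  assumes f: "\<And>b. b \<in> Basis \<Longrightarrow> integrable lborel (f b)"
  shows integrable_prod_Basis: "integrable lborel (\<lambda>x. \<Prod>b\<in>Basis. f b (x \<bullet> b))"
    and integral_prod_Basis: "(LINT x|lborel. (\<Prod>b\<in>Basis. f b (x \<bullet> b))) = (\<Prod>b\<in>Basis. (LINT t|lborel. f b t))"
proof -
  interpret product_sigma_finite "\<lambda>_::'a. lborel :: real measure" by standard
  have m: "(\<lambda>x::'a. \<Prod>b\<in>Basis. f b (x \<bullet> b)) \<in> borel_measurable borel"
  proof (rule borel_measurable_prod)
    fix b :: 'a assume "b \<in> Basis"
    then have [measurable]: "f b \<in> borel_measurable borel" using borel_measurable_integrable[OF f] by simp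
    show "(\<lambda>x. f b (x \<bullet> b)) \<in> borel_measurable borel" by measurable
  qed
  have T: "(\<lambda>y::'a \<Rightarrow> real. \<Sum>b\<in>Basis. y b *\<^sub>R b) \<in> measurable (\<Pi>\<^sub>M b\<in>Basis. lborel) borel"
    by measurable
  have e: "(\<Prod>b\<in>Basis. f b ((\<Sum>b\<in>Basis. y b *\<^sub>R b) \<bullet> b)) = (\<Prod>b\<in>Basis. f b (y b))" for y
    by (intro prod.cong) auto
  show "integrable lborel (\<lambda>x. \<Prod>b\<in>Basis. f b (x \<bullet> b))"
    unfolding lborel_eq[where 'a='a] using product_integrable_prod[of Basis f] f
    by (subst integrable_distr_eq[OF T]) (auto simp: e m)
  show "(LINT x|lborel. (\<Prod>b\<in>Basis. f b (x \<bullet> b))) = (\<Prod>b\<in>Basis. (LINT t|lborel. f b t))"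
    unfolding lborel_eq[where 'a='a] using product_integral_prod[of Basis f] f
    by (subst integral_distr[OF T]) (auto simp: e m)
qed

text \<open>
  Both Fourier integrals are treated at once: \<open>\<sigma> = -1\<close> gives the transform and \<open>\<sigma> = 1\<close> its inverse.
\<close>

definition ftrans :: "real \<Rightarrow> ('a::euclidean_space \<Rightarrow> complex) \<Rightarrow> 'a \<Rightarrow> complex" where
  "ftrans \<sigma> f \<omega> = (LINT x|lborel. cis (\<sigma> * (2 * pi * (x \<bullet> \<omega>))) * f x)"

lemma cis_measurable [measurable]: "cis \<in> borel_measurable borel"
  by (intro borel_measurable_continuous_onI continuous_intros)

lemma ftrans_measurable [measurable]:
  assumes [measurable]: "f \<in> borel_measurable borel"
  shows "ftrans \<sigma> f \<in> borel_measurable borel"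
  unfolding ftrans_def
  by (intro lborel.borel_measurable_lebesgue_integral[of _ borel, simplified]) simp

lemma integrable_cis_mult:
  fixes f :: "'a::euclidean_space \<Rightarrow> complex"
  assumes "integrable lborel f" and [measurable]: "g \<in> borel_measurable borel"
  shows "integrable lborel (\<lambda>x. cis (g x) * f x)"
  by (rule Bochner_Integration.integrable_bound[OF assms(1)])
    (use borel_measurable_integrable[OF assms(1)] in \<open>auto simp: norm_mult\<close>)

lemma integrable_bounded_mult:
  fixes h u :: "'a::euclidean_space \<Rightarrow> complex"
  assumes h: "integrable lborel h" and [measurable]: "u \<in> borel_measurable borel" and u: "\<And>x. cmod (u x) \<le> C"
  shows "integrable lborel (\<lambda>x. u x * h x)"
proof (rule Bochner_Integration.integrable_bound)
  show "integrable lborel (\<lambda>x. C * cmod (h x))" using h by simp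
  show "(\<lambda>x. u x * h x) \<in> borel_measurable lborel"
    using borel_measurable_integrable[OF h] by measurable
  have "cmod (u x * h x) \<le> norm (C * cmod (h x))" for x
    unfolding norm_mult real_norm_def
    by (intro order_trans[OF mult_right_mono[OF u norm_ge_zero] abs_ge_self])
  then show "AE x in lborel. norm (u x * h x) \<le> norm (C * cmod (h x))" by auto
qed

lemma ftrans_bound:
  assumes "integrable lborel f"
  shows "cmod (ftrans \<sigma> f \<omega>) \<le> (LINT x|lborel. cmod (f x))"
  unfolding ftrans_def by (rule order_trans[OF integral_norm_bound]) (simp add: norm_mult)

lemma ftrans_continuous:
  fixes f :: "'a::euclidean_space \<Rightarrow> complex"
  assumes f: "integrable lborel f" shows "continuous_on UNIV (ftrans \<sigma> f)"
proof (rule continuous_on_sequentiallyI)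
  fix u :: "nat \<Rightarrow> 'a" and a assume "\<forall>n. u n \<in> UNIV" "a \<in> UNIV" "u \<longlonglongrightarrow> a"
  note [measurable] = borel_measurable_integrable[OF f]
  show "(\<lambda>n. ftrans \<sigma> f (u n)) \<longlonglongrightarrow> ftrans \<sigma> f a"
    unfolding ftrans_def
  proof (rule integral_dominated_convergence[where w="\<lambda>x. cmod (f x)"])
    have "(\<lambda>n. cis (\<sigma> * (2 * pi * (x \<bullet> u n))) * f x) \<longlonglongrightarrow> cis (\<sigma> * (2 * pi * (x \<bullet> a))) * f x" for x
    proof -
      have "isCont cis t" for t using continuous_on_cis[of UNIV "\<lambda>t. t"] by (simp add: continuous_on_eq_continuous_at)
      then have "(\<lambda>n. cis (\<sigma> * (2 * pi * (x \<bullet> u n)))) \<longlonglongrightarrow> cis (\<sigma> * (2 * pi * (x \<bullet> a)))"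
        using \<open>u \<longlonglongrightarrow> a\<close> by (intro isCont_tendsto_compose[of _ cis] tendsto_intros)
      then show ?thesis by (intro tendsto_mult tendsto_const)
    qed
    then show "AE x in lborel. (\<lambda>n. cis (\<sigma> * (2 * pi * (x \<bullet> u n))) * f x) \<longlonglongrightarrow> cis (\<sigma> * (2 * pi * (x \<bullet> a))) * f x"
      by (intro AE_I2)
  qed (use f in \<open>auto simp: norm_mult\<close>)
qed

lemma integrable_pair_kernel:
  fixes f u :: "'a::euclidean_space \<Rightarrow> complex"
  assumes f: "integrable lborel f" and u: "integrable lborel u"
    and [measurable]: "(\<lambda>(x, y). k x y) \<in> borel_measurable (lborel \<Otimes>\<^sub>M lborel)"
    and k: "\<And>x y. cmod (k x y) \<le> 1"
  shows "integrable (lborel \<Otimes>\<^sub>M lborel) (\<lambda>(x, y). f x * (k x y * u y))"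
proof (rule lborel_pair.Fubini_integrable)
  note [measurable] = borel_measurable_integrable[OF f] borel_measurable_integrable[OF u]
  show "(\<lambda>(x, y). f x * (k x y * u y)) \<in> borel_measurable (lborel \<Otimes>\<^sub>M lborel)"
    by measurable
  have ku: "cmod (k x y * u y) \<le> cmod (u y)" for x y
    by (simp add: norm_mult mult_left_le_one_le k)
  have i: "integrable lborel (\<lambda>y. k x y * u y)" for x
    by (rule Bochner_Integration.integrable_bound[OF u]) (auto simp: ku)
  then show "AE x in lborel. integrable lborel (\<lambda>y. case (x, y) of (x, y) \<Rightarrow> f x * (k x y * u y))"
    by auto
  show "integrable lborel (\<lambda>x. LINT y|lborel. norm (case (x, y) of (x, y) \<Rightarrow> f x * (k x y * u y)))"
  proof (rule Bochner_Integration.integrable_bound)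
    show "integrable lborel (\<lambda>x. cmod (f x) * (LINT y|lborel. cmod (u y)))"
      using f by simp
    have "(LINT y|lborel. cmod (f x * (k x y * u y))) \<le> (LINT y|lborel. cmod (f x) * cmod (u y))" for x
      unfolding norm_mult[of "f x"] using i u ku by (intro integral_mono mult_left_mono) auto
    then show "AE x in lborel. norm (LINT y|lborel. norm (case (x, y) of (x, y) \<Rightarrow> f x * (k x y * u y)))
        \<le> norm (cmod (f x) * (LINT y|lborel. cmod (u y)))"
      by simp
  qed measurable
qed

lemma Fubini_kernel:
  fixes f u :: "'a::euclidean_space \<Rightarrow> complex"
  assumes f: "integrable lborel f" and u: "integrable lborel u"
    and k: "(\<lambda>(x, y). k x y) \<in> borel_measurable (lborel \<Otimes>\<^sub>M lborel)" "\<And>x y. cmod (k x y) \<le> 1"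
  shows "(LINT x|lborel. f x * (LINT y|lborel. k x y * u y)) = (LINT y|lborel. (LINT x|lborel. k x y * f x) * u y)"
proof -
  have "(LINT x|lborel. f x * (LINT y|lborel. k x y * u y)) = (LINT x|lborel. LINT y|lborel. f x * (k x y * u y))"
    by simp
  also have "\<dots> = (LINT y|lborel. LINT x|lborel. f x * (k x y * u y))"
    by (rule lborel_pair.Fubini_integral[symmetric]) (rule integrable_pair_kernel[OF assms])
  also have "\<dots> = (LINT y|lborel. LINT x|lborel. (k x y * f x) * u y)"
    by (simp only: mult_ac)
  finally show ?thesis by simp
qed

text \<open>
  Both sides are the double integral of $f(x)\,u(\omega)$ times the symmetric bounded kernel of the
  transform.
\<close>

lemma multiplication_formula:
  assumes "integrable lborel f" "integrable lborel u"
  shows "(LINT \<omega>|lborel. ftrans \<sigma> f \<omega> * u \<omega>) = (LINT x|lborel. f x * ftrans \<sigma> u x)"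
proof -
  let ?k = "\<lambda>x \<omega>::'a. cis (\<sigma> * (2 * pi * (x \<bullet> \<omega>)))"
  have "(LINT x|lborel. f x * (LINT y|lborel. ?k x y * u y)) =
     (LINT y|lborel. (LINT x|lborel. ?k x y * f x) * u y)"
    by (rule Fubini_kernel) (use assms in simp_all)
  then show ?thesis by (simp add: ftrans_def inner_commute)
qed

lemma ftrans_cnj: "cnj (ftrans \<sigma> f \<omega>) = ftrans (- \<sigma>) (\<lambda>x. cnj (f x)) \<omega>"
  unfolding ftrans_def by (subst Bochner_Integration.integral_cnj[symmetric]) (simp add: cis_cnj)

lemma ftrans_modulate:
  "ftrans \<sigma> (\<lambda>x. cis (\<sigma> * (2 * pi * (x \<bullet> a))) * f x) \<omega> = ftrans \<sigma> f (a + \<omega>)"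
  unfolding ftrans_def by (simp add: inner_add_right distrib_left mult.assoc[symmetric] cis_mult add.commute)

lemma ftrans_translate:
  assumes [measurable]: "f \<in> borel_measurable borel"
  shows "ftrans \<sigma> (\<lambda>x. f (x - a)) \<omega> = cis (\<sigma> * (2 * pi * (a \<bullet> \<omega>))) * ftrans \<sigma> f \<omega>"
proof -
  have "ftrans \<sigma> (\<lambda>x. f (x - a)) \<omega> = (LINT x|lborel. cis (\<sigma> * (2 * pi * ((a + x) \<bullet> \<omega>))) * f (a + x - a))"
    unfolding ftrans_def by (rule integral_translate[symmetric]) simp
  also have "\<dots> = (LINT x|lborel. cis (\<sigma> * (2 * pi * (a \<bullet> \<omega>))) * (cis (\<sigma> * (2 * pi * (x \<bullet> \<omega>))) * f x))"
    by (simp add: inner_add_left distrib_left mult.assoc[symmetric] cis_mult)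
  finally show ?thesis by (simp add: ftrans_def)
qed

section \<open>Gaussians and their Fourier integrals\<close>

definition gauss :: "real \<Rightarrow> 'a::euclidean_space \<Rightarrow> 'a \<Rightarrow> real" where
  "gauss s a x = exp (- pi * s * (norm (x - a))\<^sup>2)"

lemma gauss_measurable [measurable]: "gauss s a \<in> borel_measurable borel"
  unfolding gauss_def by measurable

lemma gauss_pos: "0 < gauss s a x" and gauss_commute: "gauss s a x = gauss s x a"
  by (simp_all add: gauss_def norm_minus_commute)

lemma gauss_le_1: "0 < s \<Longrightarrow> gauss s a x \<le> 1"
  by (simp add: gauss_def)

text \<open>
  A rescaling of the characteristic function of the standard normal distribution.
\<close>

lemma
  assumes s: "0 < s"
  shows integrable_gauss_1: "integrable lborel (\<lambda>t. exp (\<i> * of_real (2 * pi * (t * w)) - of_real (pi * s * t\<^sup>2)))"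
    and integral_gauss_1: "(LINT t|lborel. exp (\<i> * of_real (2 * pi * (t * w)) - of_real (pi * s * t\<^sup>2)))
      = of_real (1 / sqrt s * exp (- (pi * w\<^sup>2 / s)))"
proof -
  let ?c = "sqrt (2 * pi * s)" and ?g = "\<lambda>t w. exp (\<i> * complex_of_real (2 * pi * (t * w)) - of_real (pi * s * t\<^sup>2))"
  have c: "?c > 0" using s by simp
  have eq: "std_normal_density (?c * t) = (1 / sqrt (2 * pi)) * exp (- (pi * s * t\<^sup>2))" for t
    using s by (simp add: std_normal_density_def power_mult_distrib)
  have "integrable lborel (\<lambda>t. std_normal_density (0 + ?c * t))"
    using c by (intro lborel_integrable_real_affine) auto
  then have "integrable lborel (\<lambda>t. sqrt (2 * pi) * std_normal_density (?c * t))" by simp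
  then have i: "integrable lborel (\<lambda>t. exp (- (pi * s * t\<^sup>2)))" by (simp add: eq)
  then show "integrable lborel (\<lambda>t. ?g t w)"
    by (rule Bochner_Integration.integrable_bound) auto
  let ?T = "2 * pi * w / ?c"
  have "char std_normal_distribution ?T = of_real (exp (- (?T\<^sup>2) / 2))"
    by (simp only: char_std_normal_distribution)
  then have "of_real (exp (- (?T\<^sup>2) / 2)) = (LINT x|std_normal_distribution. iexp (?T * x))"
    unfolding char_def by (rule sym)
  also have "\<dots> = (LINT x|lborel. std_normal_density x *\<^sub>R iexp (?T * x))"
    by (rule integral_density) auto
  also have "\<dots> = \<bar>?c\<bar> *\<^sub>R (LINT t|lborel. std_normal_density (0 + ?c * t) *\<^sub>R iexp (?T * (0 + ?c * t)))"
    using c by (intro lborel_integral_real_affine) auto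
  also have "(\<lambda>t. std_normal_density (0 + ?c * t) *\<^sub>R iexp (?T * (0 + ?c * t))) =
     (\<lambda>t. of_real (1 / sqrt (2 * pi)) * ?g t w)"
  proof
    fix t
    have arg: "?T * (0 + ?c * t) = 2 * pi * (t * w)" using s by (simp add: field_simps)
    have split: "?g t w = exp (\<i> * complex_of_real (2 * pi * (t * w))) * of_real (exp (- (pi * s * t\<^sup>2)))"
      by (simp only: diff_conv_add_uminus exp_add exp_of_real of_real_minus[symmetric])
    show "std_normal_density (0 + ?c * t) *\<^sub>R iexp (?T * (0 + ?c * t)) =
        of_real (1 / sqrt (2 * pi)) * ?g t w"
      unfolding arg split unfolding add_0 eq scaleR_conv_of_real by (simp only: of_real_mult mult_ac)
  qed
  also have "\<bar>?c\<bar> *\<^sub>R (LINT t|lborel. of_real (1 / sqrt (2 * pi)) * ?g t w) = of_real (sqrt s) * (LINT t|lborel. ?g t w)"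
    using s by (simp add: scaleR_conv_of_real real_sqrt_mult)
  also have "- (?T\<^sup>2) / 2 = - (pi * w\<^sup>2 / s)"
    using s by (simp add: power_divide power_mult_distrib power2_eq_square field_simps)
  finally show "(LINT t|lborel. ?g t w) = of_real (1 / sqrt s * exp (- (pi * w\<^sup>2 / s)))"
    using s by (simp add: field_simps)
qed

lemma
  fixes \<omega> :: "'a::euclidean_space"
  assumes s: "0 < s"
  shows integrable_gauss_0: "integrable lborel (\<lambda>x::'a. complex_of_real (gauss s 0 x))"
    and ftrans_gauss_0: "\<bar>\<sigma>\<bar> = 1 \<Longrightarrow> ftrans \<sigma> (\<lambda>x. of_real (gauss s 0 x)) \<omega> =
      of_real ((1 / sqrt s) ^ DIM('a) * gauss (1 / s) 0 \<omega>)"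
proof -
  have nsq: "(norm x)\<^sup>2 = (\<Sum>b\<in>Basis. (x \<bullet> b)\<^sup>2)" for x :: 'a
    unfolding power2_norm_eq_inner by (subst euclidean_inner) (simp add: power2_eq_square)
  have P: "cis (2 * pi * (x \<bullet> v)) * of_real (gauss s 0 x) =
     (\<Prod>b\<in>Basis. exp (\<i> * of_real (2 * pi * ((x \<bullet> b) * (v \<bullet> b))) - of_real (pi * s * (x \<bullet> b)\<^sup>2)))" for x v :: 'a
  proof -
    have "2 * pi * (x \<bullet> v) = (\<Sum>b\<in>Basis. 2 * pi * ((x \<bullet> b) * (v \<bullet> b)))"
      by (subst euclidean_inner) (simp add: sum_distrib_left)
    moreover have "- pi * s * (norm (x - 0))\<^sup>2 = - (\<Sum>b\<in>Basis. pi * s * (x \<bullet> b)\<^sup>2)"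
      by (simp add: nsq sum_distrib_left mult.assoc sum_negf)
    ultimately show ?thesis
      unfolding gauss_def cis_conv_exp exp_of_real[symmetric] exp_sum[OF finite_Basis, symmetric] mult_exp_exp
      by (simp only: of_real_sum of_real_minus sum_distrib_left sum_subtractf diff_conv_add_uminus sum_negf sum.distrib)
  qed
  have I: "integrable lborel (\<lambda>x. cis (2 * pi * (x \<bullet> v)) * of_real (gauss s 0 x))" for v :: 'a
    unfolding P by (intro integrable_prod_Basis[where f="\<lambda>b t. exp (\<i> * of_real (2 * pi * (t * (v \<bullet> b))) - of_real (pi * s * t\<^sup>2))"] integrable_gauss_1 s)
  show "integrable lborel (\<lambda>x::'a. complex_of_real (gauss s 0 x))"
    using I[of 0] by simp
  assume \<sigma>: "\<bar>\<sigma>\<bar> = 1"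
  define v where "v = \<sigma> *\<^sub>R \<omega>"
  have "ftrans \<sigma> (\<lambda>x. of_real (gauss s 0 x)) \<omega> = (LINT x|lborel. cis (2 * pi * (x \<bullet> v)) * of_real (gauss s 0 x))"
    by (simp add: ftrans_def v_def mult_ac)
  also have "\<dots> = (\<Prod>b\<in>Basis. of_real (1 / sqrt s * exp (- (pi * (v \<bullet> b)\<^sup>2 / s))))"
    unfolding P using s
    by (subst integral_prod_Basis[where f="\<lambda>b t. exp (\<i> * of_real (2 * pi * (t * (v \<bullet> b))) - of_real (pi * s * t\<^sup>2))"])
      (simp_all only: integrable_gauss_1 integral_gauss_1)
  also have "\<dots> = of_real ((1 / sqrt s) ^ DIM('a) * (\<Prod>b\<in>Basis. exp (- (pi * (v \<bullet> b)\<^sup>2 / s))))"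
    by (simp only: of_real_prod[symmetric] prod.distrib prod_constant)
  also have "(\<Prod>b\<in>Basis. exp (- (pi * (v \<bullet> b)\<^sup>2 / s))) = gauss (1 / s) 0 v"
    by (simp add: gauss_def nsq exp_sum[symmetric] sum_negf sum_distrib_left sum_divide_distrib)
  also have "gauss (1 / s) 0 v = gauss (1 / s) 0 \<omega>"
    using \<sigma> by (simp add: gauss_def v_def)
  finally show "ftrans \<sigma> (\<lambda>x. of_real (gauss s 0 x)) \<omega> = of_real ((1 / sqrt s) ^ DIM('a) * gauss (1 / s) 0 \<omega>)" .
qed

lemma gauss_shift: "gauss s a x = gauss s 0 (x - a)"
  by (simp add: gauss_def)

lemma integrable_gauss_complex: "0 < s \<Longrightarrow> integrable lborel (\<lambda>x::'a::euclidean_space. complex_of_real (gauss s a x))"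
  using integrable_translate[of "\<lambda>x::'a. complex_of_real (gauss s 0 x)" "-a"] integrable_gauss_0[where 'a='a]
  by (simp add: gauss_shift[of s a])

lemma integrable_gauss: "0 < s \<Longrightarrow> integrable lborel (gauss s a)"
  using integrable_gauss_complex[of s a] unfolding complex_of_real_integrable_eq .

lemma ftrans_gauss:
  fixes \<omega> :: "'a::euclidean_space"
  assumes "0 < s" "\<bar>\<sigma>\<bar> = 1"
  shows "ftrans \<sigma> (\<lambda>x. of_real (gauss s a x)) \<omega> =
      of_real ((1 / sqrt s) ^ DIM('a)) * (cis (\<sigma> * (2 * pi * (\<omega> \<bullet> a))) * of_real (gauss (1 / s) 0 \<omega>))"
  using ftrans_translate[of "\<lambda>x. of_real (gauss s 0 x)" \<sigma> a \<omega>] ftrans_gauss_0[OF assms(1), of \<sigma> \<omega>] assms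
  by (simp add: gauss_shift[of s a] inner_commute)

lemma integral_gauss:
  assumes "0 < s"
  shows "(LINT x|lborel. gauss s (a::'a::euclidean_space) x) = (1 / sqrt s) ^ DIM('a)"
proof -
  have "complex_of_real (LINT x|lborel. gauss s a x) = of_real ((1 / sqrt s) ^ DIM('a))"
    using ftrans_gauss[OF assms, of 1 a 0] by (simp add: ftrans_def gauss_def)
  then show ?thesis by (simp only: of_real_eq_iff)
qed

section \<open>Functions orthogonal to all Gaussians\<close>

text \<open>
  Integrating the hypothesis against \<open>\<phi>\<close> shows that \<open>h\<close> is orthogonal to every convolution of \<open>\<phi>\<close>
  with a Gaussian. As the Gaussians concentrate, these convolutions tend to \<open>\<phi>\<close> pointwise and
  boundedly.
\<close>

lemma gauss_orthogonal_continuous: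
  fixes h :: "'a::euclidean_space \<Rightarrow> complex"
  assumes h: "integrable lborel h"
    and ortho: "\<And>a s. 0 < s \<Longrightarrow> (LINT x|lborel. of_real (gauss s a x) * h x) = 0"
    and \<phi>: "continuous_on UNIV \<phi>" "\<And>x. \<bar>\<phi> x\<bar> \<le> (1::real)" "integrable lborel \<phi>"
  shows "(LINT x|lborel. of_real (\<phi> x) * h x) = 0"
proof -
  let ?G = "gauss 1 (0::'a)"
  have [measurable]: "\<phi> \<in> borel_measurable borel" using \<phi>(1) by (rule borel_measurable_continuous_onI)
  have [measurable]: "h \<in> borel_measurable borel" using borel_measurable_integrable[OF h] by simp
  have G: "integrable lborel ?G" by (rule integrable_gauss) simp
  have G1: "(LINT b|lborel. ?G b) = 1" by (simp add: integral_gauss)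
  \<comment> \<open>The convolution of \<open>\<phi>\<close> with the Gaussian of mass one and width \<open>1 / (n + 1)\<close>, rescaled to a fixed
    Gaussian so that dominated convergence applies.\<close>
  define m where "m n x = (LINT b|lborel. \<phi> (x + (1 / (real n + 1)) *\<^sub>R b) * ?G b)" for n :: nat and x
  have m_meas [measurable]: "m n \<in> borel_measurable borel" for n
    unfolding m_def by (intro lborel.borel_measurable_lebesgue_integral[of _ borel, simplified]) simp
  have mG: "\<bar>\<phi> y * ?G b\<bar> \<le> ?G b" for y b
    using \<phi>(2)[of y] gauss_pos[of 1 0 b] by (simp add: abs_mult mult_left_le_one_le)
  have m_int: "integrable lborel (\<lambda>b. \<phi> (x + c *\<^sub>R b) * ?G b)" for x c
    by (rule Bochner_Integration.integrable_bound[OF G]) (use mG in \<open>auto simp: gauss_pos less_imp_le\<close>)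
  have m_le: "\<bar>m n x\<bar> \<le> 1" for n x
  proof -
    have "\<bar>m n x\<bar> \<le> (LINT b|lborel. \<bar>\<phi> (x + (1 / (real n + 1)) *\<^sub>R b) * ?G b\<bar>)"
      unfolding m_def by (rule integral_abs_bound)
    also have "\<dots> \<le> (LINT b|lborel. ?G b)"
      using m_int G mG by (intro integral_mono) auto
    finally show ?thesis by (simp add: G1)
  qed
  have m_lim: "(\<lambda>n. m n x) \<longlonglongrightarrow> \<phi> x" for x
  proof -
    have "(\<lambda>n. m n x) \<longlonglongrightarrow> (LINT b|lborel. \<phi> x * ?G b)"
      unfolding m_def
    proof (rule integral_dominated_convergence[OF _ _ G])
      show "AE b in lborel. (\<lambda>n. \<phi> (x + (1 / (real n + 1)) *\<^sub>R b) * ?G b) \<longlonglongrightarrow> \<phi> x * ?G b"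
      proof (rule AE_I2)
        fix b
        have "(\<lambda>n. 1 / (real n + 1)) \<longlonglongrightarrow> 0"
          using LIMSEQ_inverse_real_of_nat by (simp add: inverse_eq_divide add.commute)
        then have "(\<lambda>n. x + (1 / (real n + 1)) *\<^sub>R b) \<longlonglongrightarrow> x + 0 *\<^sub>R b" by (intro tendsto_intros)
        then have "(\<lambda>n. \<phi> (x + (1 / (real n + 1)) *\<^sub>R b)) \<longlonglongrightarrow> \<phi> x"
          using \<phi>(1) continuous_on_tendsto_compose[of UNIV \<phi>] by simp
        then show "(\<lambda>n. \<phi> (x + (1 / (real n + 1)) *\<^sub>R b) * ?G b) \<longlonglongrightarrow> \<phi> x * ?G b"
          by (intro tendsto_intros)
      qed
    qed (use mG in auto)
    then show ?thesis by (simp add: G1)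
  qed
  have zero: "(LINT x|lborel. of_real (m n x) * h x) = 0" for n
  proof -
    let ?r = "(real n + 1)\<^sup>2"
    have r: "?r > 0" by simp
    have mm: "complex_of_real (m n x) = of_real ((real n + 1) ^ DIM('a)) * (LINT a|lborel. of_real (gauss ?r x a) * of_real (\<phi> a))" for x
    proof -
      have "(LINT a|lborel. \<phi> a * gauss ?r x a) = \<bar>1 / (real n + 1)\<bar> ^ DIM('a) *\<^sub>R
          (LINT b|lborel. \<phi> (x + (1 / (real n + 1)) *\<^sub>R b) * gauss ?r x (x + (1 / (real n + 1)) *\<^sub>R b))"
        by (rule integral_affine) auto
      also have "(\<lambda>b. gauss ?r x (x + (1 / (real n + 1)) *\<^sub>R b)) = ?G"
        by (auto simp: gauss_def power_mult_distrib power_divide)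
      finally have "(LINT a|lborel. \<phi> a * gauss ?r x a) = (1 / (real n + 1)) ^ DIM('a) * m n x"
        by (simp add: m_def)
      then have "m n x = (real n + 1) ^ DIM('a) * (LINT a|lborel. gauss ?r x a * \<phi> a)"
        by (simp add: power_divide field_simps mult.commute)
      then show ?thesis
        by (metis (no_types, lifting) Bochner_Integration.integral_cong integral_complex_of_real of_real_mult)
    qed
    have "(LINT x|lborel. h x * (LINT a|lborel. of_real (gauss ?r x a) * of_real (\<phi> a))) =
       (LINT a|lborel. (LINT x|lborel. of_real (gauss ?r x a) * h x) * of_real (\<phi> a))"
    proof (rule Fubini_kernel[OF h])
      show "(\<lambda>(x, a). complex_of_real (gauss ?r x a)) \<in> borel_measurable (lborel \<Otimes>\<^sub>M lborel)"
        unfolding gauss_def by measurable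
      show "cmod (of_real (gauss ?r x a)) \<le> 1" for x a :: 'a
        using gauss_le_1[OF r, of x a] gauss_pos[of ?r x a] by simp
    qed (use \<phi>(3) in simp)
    also have "\<dots> = 0" using ortho[OF r] by (simp add: gauss_commute[of ?r])
    finally have "(LINT x|lborel. of_real ((real n + 1) ^ DIM('a)) *
        (h x * (LINT a|lborel. of_real (gauss ?r x a) * of_real (\<phi> a)))) = 0"
      by (subst integral_mult_right_zero) simp
    then show ?thesis by (simp only: mm mult_ac)
  qed
  have "(\<lambda>n. LINT x|lborel. of_real (m n x) * h x) \<longlonglongrightarrow> (LINT x|lborel. of_real (\<phi> x) * h x)"
  proof (rule integral_dominated_convergence[where w="\<lambda>x. cmod (h x)"])
    show "AE x in lborel. (\<lambda>n. of_real (m n x) * h x) \<longlonglongrightarrow> of_real (\<phi> x) * h x"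
      using m_lim by (intro AE_I2 tendsto_intros)
    show "AE x in lborel. cmod (of_real (m n x) * h x) \<le> cmod (h x)" for n
      using m_le by (intro AE_I2) (simp add: norm_mult mult_left_le_one_le)
  qed (use h in auto)
  then show ?thesis by (simp add: zero LIMSEQ_const_iff)
qed

text \<open>
  The indicator of an open set is the limit of the continuous functions
  $\min(1, k\,\mathrm{dist}(x, -U))$. The factor \<open>gauss (1 / (k + 1)) 0\<close>, which tends to 1, makes them integrable.
\<close>

lemma gauss_orthogonal_open:
  fixes h :: "'a::euclidean_space \<Rightarrow> complex"
  assumes h: "integrable lborel h"
    and ortho: "\<And>a s. 0 < s \<Longrightarrow> (LINT x|lborel. of_real (gauss s a x) * h x) = 0"
    and U: "open U"
  shows "(LINT x:U|lborel. h x) = 0"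
proof -
  have [measurable]: "h \<in> borel_measurable borel" using borel_measurable_integrable[OF h] by simp
  have [measurable]: "U \<in> sets borel" using U by simp
  \<comment> \<open>\<open>infdist\<close> to the empty set is zero, hence the case distinction.\<close>
  define \<psi> :: "nat \<Rightarrow> 'a \<Rightarrow> real" where
    "\<psi> k x = (if U = UNIV then 1 else min 1 (real k * infdist x (- U)))" for k x
  define \<phi> where "\<phi> k x = \<psi> k x * gauss (1 / (real k + 1)) 0 x" for k x
  have \<psi>: "0 \<le> \<psi> k x" "\<psi> k x \<le> 1" for k x by (auto simp: \<psi>_def infdist_nonneg)
  have cont\<psi>: "continuous_on UNIV (\<psi> k)" for k
    unfolding \<psi>_def by (cases "U = UNIV") (auto intro!: continuous_intros)
  have cont: "continuous_on UNIV (\<phi> k)" for k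
    unfolding \<phi>_def gauss_def by (intro continuous_intros cont\<psi>)
  have [measurable]: "\<phi> k \<in> borel_measurable borel" for k
    using cont by (rule borel_measurable_continuous_onI)
  have \<phi>_gauss: "\<bar>\<phi> k x\<bar> \<le> gauss (1 / (real k + 1)) 0 x" for k x
    using \<psi>[of k x] gauss_pos[of "1 / (real k + 1)" 0 x] by (simp add: \<phi>_def abs_mult mult_left_le_one_le)
  have \<phi>_le: "\<bar>\<phi> k x\<bar> \<le> 1" for k x
    using \<phi>_gauss[of k x] gauss_le_1[of "1 / (real k + 1)" 0 x] by simp
  have \<phi>_int: "integrable lborel (\<phi> k)" for k
    by (rule Bochner_Integration.integrable_bound[OF integrable_gauss[of "1 / (real k + 1)" 0]])
      (use \<phi>_gauss gauss_pos in \<open>auto intro: order_trans[OF _ abs_ge_self]\<close>)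
  have \<psi>_lim: "(\<lambda>k. \<psi> k x) \<longlonglongrightarrow> indicator U x" for x
  proof (cases "U = UNIV")
    case False
    show ?thesis
    proof (cases "x \<in> U")
      case True
      have d: "infdist x (- U) > 0"
        using True U False by (intro infdist_pos_not_in_closed) auto
      obtain M :: nat where M: "real M > 1 / infdist x (- U)" using reals_Archimedean2 by blast
      have "\<psi> k x = 1" if "k \<ge> M" for k
      proof -
        have "1 < real M * infdist x (- U)" using M d by (simp add: field_simps)
        also have "\<dots> \<le> real k * infdist x (- U)" using that d by (intro mult_right_mono) auto
        finally show ?thesis using False by (simp add: \<psi>_def)
      qed
      then show ?thesis using True by (intro tendsto_eventually) (auto simp: eventually_sequentially)
    next
      case x: False
      then show ?thesis using False by (simp add: \<psi>_def)
    qed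
  qed (simp add: \<psi>_def)
  have g_lim: "(\<lambda>k. gauss (1 / (real k + 1)) 0 x) \<longlonglongrightarrow> 1" for x :: 'a
  proof -
    have "(\<lambda>k. 1 / (real k + 1)) \<longlonglongrightarrow> 0"
      using LIMSEQ_inverse_real_of_nat by (simp add: inverse_eq_divide add.commute)
    then have "(\<lambda>k. exp (- pi * (1 / (real k + 1)) * (norm (x - 0))\<^sup>2)) \<longlonglongrightarrow> exp (- pi * 0 * (norm (x - 0))\<^sup>2)"
      by (intro tendsto_intros)
    then show ?thesis by (simp add: gauss_def)
  qed
  have "(\<lambda>k. LINT x|lborel. of_real (\<phi> k x) * h x) \<longlonglongrightarrow> (LINT x|lborel. of_real (indicator U x) * h x)"
  proof (rule integral_dominated_convergence[where w="\<lambda>x. cmod (h x)"])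
    have "(\<lambda>k. \<phi> k x) \<longlonglongrightarrow> indicator U x" for x
      using tendsto_mult[OF \<psi>_lim g_lim, of x x] by (simp add: \<phi>_def)
    then show "AE x in lborel. (\<lambda>k. of_real (\<phi> k x) * h x) \<longlonglongrightarrow> of_real (indicator U x) * h x"
      by (intro AE_I2 tendsto_intros)
    show "AE x in lborel. cmod (of_real (\<phi> n x) * h x) \<le> cmod (h x)" for n
      using \<phi>_le by (intro AE_I2) (simp add: norm_mult mult_left_le_one_le)
  qed (use h in auto)
  moreover have "(LINT x|lborel. of_real (\<phi> k x) * h x) = 0" for k
    by (rule gauss_orthogonal_continuous[OF h ortho cont \<phi>_le \<phi>_int])
  ultimately show ?thesis by (simp add: LIMSEQ_const_iff set_lebesgue_integral_def scaleR_conv_of_real)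
qed

text \<open>
  The open sets are stable under intersection and generate the Borel sets, so the integral of \<open>h\<close>
  vanishes over every Borel set.
\<close>

lemma gauss_orthogonal_L1_zero:
  fixes h :: "'a::euclidean_space \<Rightarrow> complex"
  assumes h: "integrable lborel h"
    and ortho: "\<And>a s. 0 < s \<Longrightarrow> (LINT x|lborel. of_real (gauss s a x) * h x) = 0"
  shows "AE x in lborel. h x = 0"
proof (rule sigma_finite_measure.density_zero[OF sigma_finite_lborel h])
  fix A :: "'a set" assume "A \<in> sets lborel"
  have si: "set_integrable lborel B h" if "B \<in> sets borel" for B
    unfolding set_integrable_def using h that by (intro integrable_mult_indicator) auto
  have gen: "Int_stable {S::'a set. open S}" by (auto simp: Int_stable_def)
  have sub: "{S::'a set. open S} \<subseteq> Pow UNIV" by auto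
  have bor: "sigma_sets UNIV {S::'a set. open S} = sets borel" by (simp add: borel_def)
  have "A \<in> sigma_sets UNIV {S. open S}" using \<open>A \<in> sets lborel\<close> by (simp add: bor)
  from gen sub this show "(LINT x:A|lborel. h x) = 0"
  proof (induction rule: sigma_sets_induct_disjoint)
    case (basic A)
    then show ?case using gauss_orthogonal_open[OF h ortho] by simp
  next
    case empty
    then show ?case by (simp add: set_lebesgue_integral_def)
  next
    case (compl A)
    then have A: "A \<in> sets borel" by (simp add: bor)
    have "(LINT x:UNIV|lborel. h x) = (LINT x:A \<union> (UNIV - A)|lborel. h x)" by simp
    also have "\<dots> = (LINT x:A|lborel. h x) + (LINT x:UNIV - A|lborel. h x)"
      using A by (intro set_integral_Un si) auto
    finally show ?case using compl gauss_orthogonal_open[OF h ortho, of UNIV] by simp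
  next
    case (union A)
    then have A: "A i \<in> sets borel" for i by (auto simp: bor)
    have "(LINT x:(\<Union>i. A i)|lborel. h x) = (\<Sum>i. (LINT x:A i|lborel. h x))"
      using A union(1) by (intro lebesgue_integral_countable_add si) (auto simp: disjoint_family_on_def)
    then show ?case using union by simp
  qed
qed

text \<open>
  Every Gaussian is the Fourier integral of a modulated Gaussian, so the multiplication formula turns
  a vanishing transform into orthogonality to all Gaussians.
\<close>

lemma ftrans_injective:
  fixes h :: "'a::euclidean_space \<Rightarrow> complex"
  assumes h: "integrable lborel h" and zero: "\<And>\<omega>. ftrans \<sigma> h \<omega> = 0" and \<sigma>: "\<bar>\<sigma>\<bar> = 1"
  shows "AE x in lborel. h x = 0"
proof (rule gauss_orthogonal_L1_zero[OF h])
  fix a :: 'a and s :: real assume s: "0 < s"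
  let ?u = "\<lambda>\<omega>::'a. cis (\<sigma> * (2 * pi * (\<omega> \<bullet> (- a)))) * of_real (gauss (1 / s) 0 \<omega>)"
  have u: "integrable lborel ?u"
    using s by (intro integrable_cis_mult integrable_gauss_complex) auto
  have Fu: "ftrans \<sigma> ?u x = of_real ((1 / sqrt (1 / s)) ^ DIM('a)) * of_real (gauss s a x)" for x
  proof -
    have "gauss s 0 (- a + x) = gauss s a x" by (simp add: gauss_def)
    then show ?thesis unfolding ftrans_modulate using s \<sigma> by (simp add: ftrans_gauss)
  qed
  have "0 = (LINT x|lborel. h x * ftrans \<sigma> ?u x)"
    using multiplication_formula[OF h u, of \<sigma>] by (simp add: zero)
  also have "\<dots> = of_real ((1 / sqrt (1 / s)) ^ DIM('a)) * (LINT x|lborel. of_real (gauss s a x) * h x)"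
    unfolding Fu by (subst integral_mult_right_zero[symmetric]) (simp only: mult_ac)
  finally show "(LINT x|lborel. of_real (gauss s a x) * h x) = 0" using s by simp
qed

lemma L2_gauss: "0 < s \<Longrightarrow> L2_on UNIV (\<lambda>x. complex_of_real (gauss s a x))"
proof -
  assume s: "0 < s"
  have "(cmod (complex_of_real (gauss s a x)))\<^sup>2 = gauss (2 * s) a x" for x
    by (simp add: gauss_def flip: exp_double)
  then show ?thesis using integrable_gauss[of "2 * s" a] s by (simp add: L2_on_UNIV_iff)
qed

text \<open>
  A square integrable function need not be integrable, so it is first damped by a Gaussian. The
  product of two Gaussians is a Gaussian, by completing the square, up to a constant.
\<close>

lemma gauss_orthogonal_L2_zero:
  fixes w :: "'a::euclidean_space \<Rightarrow> complex"
  assumes w: "L2_on UNIV w"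
    and ortho: "\<And>a s. 0 < s \<Longrightarrow> (LINT x|lborel. of_real (gauss s a x) * w x) = 0"
  shows "AE x in lborel. w x = 0"
proof -
  let ?h = "\<lambda>x. of_real (gauss 1 0 x) * w x"
  have "AE x in lborel. ?h x = 0"
  proof (rule gauss_orthogonal_L1_zero)
    show "integrable lborel ?h" by (intro L2_mult_integrable L2_gauss w) simp
    fix a :: 'a and s :: real assume s: "0 < s"
    define b where "b = (s / (s + 1)) *\<^sub>R a"
    define c where "c = exp (- pi * (s / (s + 1)) * (norm a)\<^sup>2)"
    have "s * (norm (x - a))\<^sup>2 + (norm x)\<^sup>2 = (s + 1) * (norm (x - b))\<^sup>2 + (s / (s + 1)) * (norm a)\<^sup>2" for x
    proof -
      have b: "(s + 1) *\<^sub>R b = s *\<^sub>R a" using s by (simp add: b_def)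
      have "(s + 1) * (x \<bullet> b) = x \<bullet> ((s + 1) *\<^sub>R b)" by simp
      then have xb: "(s + 1) * (x \<bullet> b) = s * (x \<bullet> a)" unfolding b by simp
      have "(s + 1) * (b \<bullet> b) = ((s + 1) *\<^sub>R b) \<bullet> b" by simp
      also have "\<dots> = s * (s / (s + 1)) * (a \<bullet> a)" unfolding b by (simp add: b_def)
      also have "\<dots> = s * (a \<bullet> a) - (s / (s + 1)) * (a \<bullet> a)" using s by (simp add: field_simps)
      finally have bb: "(s + 1) * (b \<bullet> b) = s * (a \<bullet> a) - (s / (s + 1)) * (a \<bullet> a)" .
      have "(s + 1) * ((x - b) \<bullet> (x - b)) = (s + 1) * (x \<bullet> x) - 2 * ((s + 1) * (x \<bullet> b)) + (s + 1) * (b \<bullet> b)"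
        by (simp add: inner_diff_left inner_diff_right inner_commute algebra_simps)
      also have "\<dots> = s * ((x - a) \<bullet> (x - a)) + x \<bullet> x - (s / (s + 1)) * (a \<bullet> a)"
        unfolding xb bb by (simp add: inner_diff_left inner_diff_right inner_commute algebra_simps)
      finally show ?thesis by (simp add: power2_norm_eq_inner)
    qed
    note square = this
    have prod: "gauss s a x * gauss 1 0 x = c * gauss (s + 1) b x" for x
    proof -
      have "gauss s a x * gauss 1 0 x = exp (- pi * (s * (norm (x - a))\<^sup>2 + (norm x)\<^sup>2))"
        by (simp add: gauss_def mult_exp_exp algebra_simps)
      also have "\<dots> = exp (- pi * ((s / (s + 1)) * (norm a)\<^sup>2) + - pi * ((s + 1) * (norm (x - b))\<^sup>2))"
        unfolding square by (simp add: algebra_simps)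
      also have "\<dots> = c * gauss (s + 1) b x"
        by (simp only: exp_add c_def gauss_def mult.assoc)
      finally show ?thesis .
    qed
    then have e: "of_real (gauss s a x) * ?h x = of_real c * (of_real (gauss (s + 1) b x) * w x)" for x
      by (simp only: mult.assoc[symmetric] of_real_mult[symmetric] prod)
    show "(LINT x|lborel. of_real (gauss s a x) * ?h x) = 0"
      unfolding e using ortho[of "s + 1" b] s by simp
  qed
  then show ?thesis
    by eventually_elim (use gauss_pos[of 1 0] in \<open>auto simp: less_le\<close>)
qed

section \<open>The Fourier transform as a contraction\<close>

text \<open>
  Schur's test in a simple case: estimate the product of \<open>cmod (f x)\<close> and \<open>cmod (f y)\<close> by the mean of their squares.
\<close>

lemma symmetric_kernel_bound:
  fixes f g :: "'a::euclidean_space \<Rightarrow> complex"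
  assumes f: "L2_on UNIV f" and [measurable]: "(\<lambda>(x, y). k x y) \<in> borel_measurable (lborel \<Otimes>\<^sub>M lborel)"
    and k: "\<And>x y. (0::real) \<le> k x y" "\<And>x y. k x y = k y x" "\<And>x. (\<integral>\<^sup>+y. ennreal (k x y) \<partial>lborel) = 1"
  shows "(\<integral>\<^sup>+x. \<integral>\<^sup>+y. ennreal (cmod (f x) * cmod (f y) * k x y) \<partial>lborel \<partial>lborel) \<le> ennreal ((L2_norm_on UNIV f)\<^sup>2)"
proof -
  note [measurable] = L2_measurable[OF f]
  let ?N = "ennreal ((L2_norm_on UNIV f)\<^sup>2)"
  let ?A = "\<integral>\<^sup>+x. \<integral>\<^sup>+y. ennreal ((cmod (f x))\<^sup>2 * k x y) \<partial>lborel \<partial>lborel"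
  let ?B = "\<integral>\<^sup>+x. \<integral>\<^sup>+y. ennreal ((cmod (f y))\<^sup>2 * k x y) \<partial>lborel \<partial>lborel"
  let ?L = "\<integral>\<^sup>+x. \<integral>\<^sup>+y. ennreal (cmod (f x) * cmod (f y) * k x y) \<partial>lborel \<partial>lborel"
  have A: "?A = ?N"
    by (simp add: ennreal_mult k nn_integral_cmult nn_integral_L2[OF f, symmetric])
  have "?B = (\<integral>\<^sup>+y. \<integral>\<^sup>+x. ennreal ((cmod (f y))\<^sup>2 * k x y) \<partial>lborel \<partial>lborel)"
    by (rule lborel_pair.Fubini'[symmetric]) measurable
  also have "\<dots> = ?A" by (intro nn_integral_cong) (subst k(2), rule refl)
  finally have B: "?B = ?N" using A by simp
  have "2 * ?L = (\<integral>\<^sup>+x. \<integral>\<^sup>+y. ennreal (2 * (cmod (f x) * cmod (f y) * k x y)) \<partial>lborel \<partial>lborel)"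
    by (simp add: ennreal_mult nn_integral_cmult k)
  also have "\<dots> \<le> (\<integral>\<^sup>+x. \<integral>\<^sup>+y. (ennreal ((cmod (f x))\<^sup>2 * k x y) + ennreal ((cmod (f y))\<^sup>2 * k x y)) \<partial>lborel \<partial>lborel)"
  proof (intro nn_integral_mono)
    fix x y :: 'a
    have "(2 * cmod (f x) * cmod (f y)) * k x y \<le> ((cmod (f x))\<^sup>2 + (cmod (f y))\<^sup>2) * k x y"
      by (intro mult_right_mono sum_squares_bound k)
    then have "ennreal (2 * (cmod (f x) * cmod (f y) * k x y)) \<le> ennreal ((cmod (f x))\<^sup>2 * k x y + (cmod (f y))\<^sup>2 * k x y)"
      by (intro ennreal_leI) (simp add: algebra_simps)
    also have "\<dots> = ennreal ((cmod (f x))\<^sup>2 * k x y) + ennreal ((cmod (f y))\<^sup>2 * k x y)"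
      by (intro ennreal_plus) (simp_all add: k)
    finally show "ennreal (2 * (cmod (f x) * cmod (f y) * k x y)) \<le> ennreal ((cmod (f x))\<^sup>2 * k x y) + ennreal ((cmod (f y))\<^sup>2 * k x y)" .
  qed
  also have "\<dots> = ?A + ?B" by (simp add: nn_integral_add)
  also have "\<dots> = 2 * ?N" unfolding A B by (simp add: mult_2)
  finally show ?thesis
    by (simp add: ennreal_mult_le_mult_iff)
qed

text \<open>
  Two applications of the multiplication formula move both transforms onto the Gaussian weight. This
  leaves the quadratic form of \<open>f\<close> with the transformed Gaussian as a kernel, which is nonnegative,
  symmetric and of mass one in each variable.
\<close>

lemma damped_ftrans_bound:
  fixes f :: "'a::euclidean_space \<Rightarrow> complex"
  assumes f: "integrable lborel f" "L2_on UNIV f" and s: "0 < s" and \<sigma>: "\<bar>\<sigma>\<bar> = 1"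
  shows "integrable lborel (\<lambda>\<omega>. gauss s 0 \<omega> * (cmod (ftrans \<sigma> f \<omega>))\<^sup>2)"
    and "(LINT \<omega>|lborel. gauss s 0 \<omega> * (cmod (ftrans \<sigma> f \<omega>))\<^sup>2) \<le> (L2_norm_on UNIV f)\<^sup>2"
proof -
  note [measurable] = L2_measurable[OF f(2)]
  let ?F = "ftrans \<sigma> f"
  define u where "u \<omega> = cnj (?F \<omega>) * complex_of_real (gauss s 0 \<omega>)" for \<omega>
  define C where "C = (1 / sqrt s) ^ DIM('a)"
  have C: "C > 0" using s by (simp add: C_def)
  let ?k = "\<lambda>x y. C * gauss (1 / s) (x::'a) y"
  have u: "integrable lborel u"
    unfolding u_def
    by (rule integrable_bounded_mult[where C="LINT x|lborel. cmod (f x)"])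
      (use f s ftrans_bound integrable_gauss_complex in \<open>auto intro: measurable_compose[OF _ borel_measurable_cnj]\<close>)
  have Fu: "?F \<omega> * u \<omega> = complex_of_real (gauss s 0 \<omega> * (cmod (?F \<omega>))\<^sup>2)" for \<omega>
    unfolding of_real_mult complex_norm_square u_def by simp
  have "integrable lborel (\<lambda>\<omega>. ?F \<omega> * u \<omega>)"
    by (rule integrable_bounded_mult[OF u, where C="LINT x|lborel. cmod (f x)"])
      (use f ftrans_bound in auto)
  then show int: "integrable lborel (\<lambda>\<omega>. gauss s 0 \<omega> * (cmod (?F \<omega>))\<^sup>2)"
    unfolding Fu complex_of_real_integrable_eq .
  have tu: "ftrans \<sigma> u x = (LINT y|lborel. cnj (f y) * of_real (?k x y))" for x
  proof -
    let ?G = "\<lambda>\<omega>. cis (- \<sigma> * (2 * pi * (\<omega> \<bullet> (- x)))) * complex_of_real (gauss s 0 \<omega>)"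
    have G: "integrable lborel ?G"
      using s by (intro integrable_cis_mult integrable_gauss_complex) auto
    have "ftrans \<sigma> u x = (LINT \<omega>|lborel. ftrans (- \<sigma>) (\<lambda>x. cnj (f x)) \<omega> * ?G \<omega>)"
      by (simp add: ftrans_def[of \<sigma> u] u_def ftrans_cnj mult_ac)
    also have "\<dots> = (LINT y|lborel. cnj (f y) * ftrans (- \<sigma>) ?G y)"
      by (rule multiplication_formula) (use f G in auto)
    also have "\<dots> = (LINT y|lborel. cnj (f y) * of_real (?k x y))"
    proof (intro Bochner_Integration.integral_cong refl arg_cong2[where f=times])
      fix y
      have "gauss (1 / s) 0 (- x + y) = gauss (1 / s) x y" by (simp add: gauss_def)
      then show "ftrans (- \<sigma>) ?G y = of_real (?k x y)"
        unfolding ftrans_modulate using s \<sigma> by (simp add: ftrans_gauss C_def)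
    qed
    finally show ?thesis .
  qed
  have "ennreal (LINT \<omega>|lborel. gauss s 0 \<omega> * (cmod (?F \<omega>))\<^sup>2) = ennreal (cmod (LINT \<omega>|lborel. ?F \<omega> * u \<omega>))"
    unfolding Fu by (simp del: of_real_mult of_real_power add: integral_nonneg_AE gauss_pos less_imp_le)
  also have "\<dots> = ennreal (cmod (LINT x|lborel. f x * ftrans \<sigma> u x))"
    using multiplication_formula[OF f(1) u, of \<sigma>] by simp
  also have "\<dots> \<le> (\<integral>\<^sup>+x. ennreal (cmod (f x * ftrans \<sigma> u x)) \<partial>lborel)"
    by (rule integral_norm_bound_ennreal[OF integrable_bounded_mult[where C="LINT x|lborel. cmod (u x)", of f "ftrans \<sigma> u", unfolded mult.commute[of _ "f _"]]])
      (use f u ftrans_bound borel_measurable_integrable[OF u] in auto)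
  also have "\<dots> \<le> (\<integral>\<^sup>+x. \<integral>\<^sup>+y. ennreal (cmod (f x) * cmod (f y) * ?k x y) \<partial>lborel \<partial>lborel)"
  proof (rule nn_integral_mono)
    fix x
    have i: "integrable lborel (\<lambda>y. cnj (f y) * of_real (?k x y))"
      using s L2_mult_integrable[OF L2_cnj[OF f(2)] L2_scale[OF L2_gauss[of "1 / s" x], of C]] by simp
    have "ennreal (cmod (f x * ftrans \<sigma> u x)) = ennreal (cmod (f x)) * ennreal (cmod (LINT y|lborel. cnj (f y) * of_real (?k x y)))"
      unfolding tu by (simp add: norm_mult ennreal_mult)
    also have "\<dots> \<le> ennreal (cmod (f x)) * (\<integral>\<^sup>+y. ennreal (cmod (cnj (f y) * of_real (?k x y))) \<partial>lborel)"
      by (intro mult_left_mono integral_norm_bound_ennreal i) auto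
    also have "\<dots> = (\<integral>\<^sup>+y. ennreal (cmod (f x) * cmod (f y) * ?k x y) \<partial>lborel)"
      using C gauss_pos[of "1 / s" x]
      by (subst nn_integral_cmult[symmetric]) (auto simp: norm_mult ennreal_mult'[symmetric] less_imp_le mult_ac)
    finally show "ennreal (cmod (f x * ftrans \<sigma> u x)) \<le> (\<integral>\<^sup>+y. ennreal (cmod (f x) * cmod (f y) * ?k x y) \<partial>lborel)" .
  qed
  also have "\<dots> \<le> ennreal ((L2_norm_on UNIV f)\<^sup>2)"
  proof (rule symmetric_kernel_bound[OF f(2)])
    show "(\<lambda>(x, y). ?k x y) \<in> borel_measurable (lborel \<Otimes>\<^sub>M lborel)" unfolding gauss_def by measurable
    show "0 \<le> ?k x y" for x y using C gauss_pos[of "1 / s" x y] by simp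
    show "?k x y = ?k y x" for x y by (simp add: gauss_commute)
    show "(\<integral>\<^sup>+y. ennreal (?k x y) \<partial>lborel) = 1" for x
    proof -
      have "(\<integral>\<^sup>+y. ennreal (?k x y) \<partial>lborel) = ennreal (LINT y|lborel. ?k x y)"
        using C s gauss_pos[of "1 / s" x] by (intro nn_integral_eq_integral integrable_mult_right integrable_gauss) (auto simp: less_imp_le)
      also have "(LINT y|lborel. ?k x y) = 1"
        using s by (simp add: integral_gauss C_def real_sqrt_divide flip: power_mult_distrib)
      finally show ?thesis by simp
    qed
  qed
  finally show "(LINT \<omega>|lborel. gauss s 0 \<omega> * (cmod (?F \<omega>))\<^sup>2) \<le> (L2_norm_on UNIV f)\<^sup>2" by simp
qed

text \<open>
  The damping is removed by letting the Gaussian weight tend to one.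
\<close>

lemma ftrans_contraction:
  fixes f :: "'a::euclidean_space \<Rightarrow> complex"
  assumes f: "integrable lborel f" "L2_on UNIV f" and \<sigma>: "\<bar>\<sigma>\<bar> = 1"
  shows "L2_on UNIV (ftrans \<sigma> f)" "L2_norm_on UNIV (ftrans \<sigma> f) \<le> L2_norm_on UNIV f"
proof -
  note [measurable] = L2_measurable[OF f(2)]
  let ?s = "\<lambda>n::nat. 1 / (real n + 1)"
  let ?g = "\<lambda>n \<omega>. complex_of_real (gauss (?s n) 0 \<omega>) * ftrans \<sigma> f \<omega>"
  have sq: "(cmod (?g n \<omega>))\<^sup>2 = gauss (2 * ?s n) 0 \<omega> * (cmod (ftrans \<sigma> f \<omega>))\<^sup>2" for n \<omega>
    by (simp add: gauss_def norm_mult power_mult_distrib flip: exp_double)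
  have s: "0 < 2 * ?s n" for n by simp
  have gL: "L2_on UNIV (?g n)" for n
    unfolding L2_on_UNIV_iff sq using damped_ftrans_bound(1)[OF f s \<sigma>] by simp
  have gn: "L2_norm_on UNIV (?g n) \<le> L2_norm_on UNIV f" for n
  proof (rule power2_le_imp_le)
    show "(L2_norm_on UNIV (?g n))\<^sup>2 \<le> (L2_norm_on UNIV f)\<^sup>2"
      unfolding L2_norm_sq[of "?g n"] sq by (rule damped_ftrans_bound(2)[OF f s \<sigma>])
  qed (rule L2_norm_nonneg)
  have lim: "(\<lambda>n. ?g n \<omega>) \<longlonglongrightarrow> ftrans \<sigma> f \<omega>" for \<omega>
  proof -
    have "?s \<longlonglongrightarrow> 0"
      using LIMSEQ_inverse_real_of_nat by (simp add: inverse_eq_divide add.commute)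
    then have "(\<lambda>n. complex_of_real (exp (- pi * ?s n * (norm (\<omega> - 0))\<^sup>2)) * ftrans \<sigma> f \<omega>) \<longlonglongrightarrow>
       complex_of_real (exp (- pi * 0 * (norm (\<omega> - 0))\<^sup>2)) * ftrans \<sigma> f \<omega>"
      by (intro tendsto_intros)
    then show ?thesis by (simp add: gauss_def)
  qed
  show "L2_on UNIV (ftrans \<sigma> f)" "L2_norm_on UNIV (ftrans \<sigma> f) \<le> L2_norm_on UNIV f"
    using L2_fatou[OF gL always_eventually[OF allI[OF gn]] AE_I2[OF lim]] by simp_all
qed

section \<open>The Fourier transform on square integrable functions\<close>

definition truncate :: "nat \<Rightarrow> ('a::euclidean_space \<Rightarrow> complex) \<Rightarrow> 'a \<Rightarrow> complex" where
  "truncate n f x = indicator (cball 0 (real n)) x *\<^sub>R f x"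

text \<open>
  The condition under which \<open>L2_fourier\<close> and \<open>L2_inv_fourier\<close> select a representative, for both signs.
\<close>

definition is_L2_ftrans :: "real \<Rightarrow> ('a::euclidean_space \<Rightarrow> complex) \<Rightarrow> ('a \<Rightarrow> complex) \<Rightarrow> bool" where
  "is_L2_ftrans \<sigma> f \<phi> \<longleftrightarrow> L2_on UNIV \<phi> \<and>
    (\<lambda>n. L2_norm_on UNIV (\<lambda>\<omega>. \<phi> \<omega> - ftrans \<sigma> (truncate n f) \<omega>)) \<longlonglongrightarrow> 0"

definition L2_ftrans :: "real \<Rightarrow> ('a::euclidean_space \<Rightarrow> complex) \<Rightarrow> 'a \<Rightarrow> complex" where
  "L2_ftrans \<sigma> f = (SOME \<phi>. is_L2_ftrans \<sigma> f \<phi>)"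

lemma ftrans_truncate:
  "ftrans \<sigma> (truncate n f) \<omega> = (LINT x:cball 0 (real n)|lborel. cis (\<sigma> * (2 * pi * (x \<bullet> \<omega>))) * f x)"
  by (simp add: ftrans_def truncate_def set_lebesgue_integral_def)

lemma L2_fourier_eq: "L2_fourier = L2_ftrans (- 1)"
  unfolding L2_fourier_def L2_ftrans_def is_L2_ftrans_def ftrans_truncate by simp

lemma L2_inv_fourier_eq: "L2_inv_fourier = L2_ftrans 1"
  unfolding L2_inv_fourier_def L2_ftrans_def is_L2_ftrans_def ftrans_truncate by (simp add: inner_commute)

lemma truncate_eq_mult: "truncate n f = (\<lambda>x. complex_of_real (indicator (cball 0 (real n)) x) * f x)"
  by (simp add: truncate_def fun_eq_iff scaleR_conv_of_real)

lemma truncate_measurable [measurable]: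
  assumes [measurable]: "f \<in> borel_measurable borel"
  shows "truncate n f \<in> borel_measurable borel"
proof -
  have [measurable]: "cball (0::'a) (real n) \<in> sets borel" by simp
  show ?thesis unfolding truncate_def by measurable
qed

lemma L2_truncate: "L2_on UNIV f \<Longrightarrow> L2_on UNIV (truncate n f)"
  unfolding truncate_eq_mult by (rule L2_bounded_mult(1)[where C=1]) (auto simp: indicator_def)

lemma L2_indicator:
  assumes [measurable]: "A \<in> sets borel" and "emeasure lborel A < \<infinity>"
  shows "L2_on UNIV (\<lambda>x. complex_of_real (indicator A x))"
proof -
  have "(cmod (complex_of_real (indicator A x)))\<^sup>2 = indicator A x" for x
    by (simp add: indicator_def)
  then show ?thesis using assms by (simp add: L2_on_UNIV_iff)
qed

lemma integrable_truncate: "L2_on UNIV f \<Longrightarrow> integrable lborel (truncate n f)"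
  unfolding truncate_eq_mult by (intro L2_mult_integrable L2_indicator emeasure_lborel_cball_finite) auto

lemma truncate_tendsto:
  fixes f :: "'a::euclidean_space \<Rightarrow> complex"
  assumes f: "L2_on UNIV f"
  shows "(\<lambda>n. L2_norm_on UNIV (\<lambda>x. f x - truncate n f x)) \<longlonglongrightarrow> 0"
proof -
  note [measurable] = L2_measurable[OF f]
  have "(\<lambda>n. LINT x|lborel. (cmod (f x - truncate n f x))\<^sup>2) \<longlonglongrightarrow> (LINT x::'a|lborel. (0::real))"
  proof (rule integral_dominated_convergence[where w="\<lambda>x. (cmod (f x))\<^sup>2"])
    show "AE x in lborel. (\<lambda>n. (cmod (f x - truncate n f x))\<^sup>2) \<longlonglongrightarrow> 0"
    proof (rule AE_I2)
      fix x :: 'a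
      obtain N :: nat where N: "norm x \<le> real N" using real_arch_simple by blast
      have "(cmod (f x - truncate n f x))\<^sup>2 = 0" if "n \<ge> N" for n
        using N that by (simp add: truncate_def)
      then show "(\<lambda>n. (cmod (f x - truncate n f x))\<^sup>2) \<longlonglongrightarrow> 0"
        by (intro tendsto_eventually) (auto simp: eventually_sequentially)
    qed
    show "AE x in lborel. norm ((cmod (f x - truncate n f x))\<^sup>2) \<le> (cmod (f x))\<^sup>2" for n
      by (auto simp: truncate_def indicator_def)
  qed (use L2_square_integrable[OF f] in simp_all)
  then have "(\<lambda>n. sqrt (LINT x|lborel. (cmod (f x - truncate n f x))\<^sup>2)) \<longlonglongrightarrow> sqrt 0"
    by (intro tendsto_intros) simp
  then show ?thesis by (simp add: L2_norm_UNIV)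
qed

lemma ftrans_diff:
  assumes "integrable lborel f" "integrable lborel g"
  shows "ftrans \<sigma> (\<lambda>x. f x - g x) \<omega> = ftrans \<sigma> f \<omega> - ftrans \<sigma> g \<omega>"
  unfolding ftrans_def right_diff_distrib
  using assms by (intro Bochner_Integration.integral_diff integrable_cis_mult) auto

lemma ftrans_diff_norm:
  assumes f: "integrable lborel f" "L2_on UNIV f" and g: "integrable lborel g" "L2_on UNIV g" and \<sigma>: "\<bar>\<sigma>\<bar> = 1"
  shows "L2_norm_on UNIV (\<lambda>\<omega>. ftrans \<sigma> f \<omega> - ftrans \<sigma> g \<omega>) \<le> L2_norm_on UNIV (\<lambda>x. f x - g x)"
  using ftrans_contraction(2)[OF Bochner_Integration.integrable_diff[OF f(1) g(1)] L2_diff[OF f(2) g(2)] \<sigma>]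
  unfolding ftrans_diff[OF f(1) g(1), of \<sigma>, THEN ext] .

lemma L2_ftrans_truncate:
  "\<lbrakk>L2_on UNIV f; \<bar>\<sigma>\<bar> = 1\<rbrakk> \<Longrightarrow> L2_on UNIV (ftrans \<sigma> (truncate n f))"
  by (intro ftrans_contraction(1) integrable_truncate L2_truncate)

lemma L2_ftrans_exists:
  assumes f: "L2_on UNIV f" and \<sigma>: "\<bar>\<sigma>\<bar> = 1"
  shows "\<exists>\<phi>. is_L2_ftrans \<sigma> f \<phi>"
proof -
  let ?s = "\<lambda>n. ftrans \<sigma> (truncate n f)" and ?e = "\<lambda>n. L2_norm_on UNIV (\<lambda>x. f x - truncate n f x)"
  have s: "L2_on UNIV (?s n)" for n by (rule L2_ftrans_truncate[OF f \<sigma>])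
  have le: "L2_norm_on UNIV (\<lambda>x. ?s m x - ?s n x) \<le> ?e m + ?e n" for m n
    using ftrans_diff_norm[OF integrable_truncate[OF f, of m] L2_truncate[OF f] integrable_truncate[OF f, of n] L2_truncate[OF f] \<sigma>]
      L2_norm_diff_triangle[OF L2_truncate[OF f, of m] f L2_truncate[OF f, of n]]
      L2_norm_diff_commute[OF L2_truncate[OF f, of m] f] by linarith
  have "\<exists>N. \<forall>m\<ge>N. \<forall>n\<ge>N. L2_norm_on UNIV (\<lambda>x. ?s m x - ?s n x) < e" if "e > 0" for e
  proof -
    obtain N where N: "\<And>n. n \<ge> N \<Longrightarrow> ?e n < e / 2"
      using LIMSEQ_D[OF truncate_tendsto[OF f], of "e / 2"] \<open>e > 0\<close> by (auto simp: L2_norm_nonneg)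
    have "L2_norm_on UNIV (\<lambda>x. ?s m x - ?s n x) < e" if "m \<ge> N" "n \<ge> N" for m n
      using le[of m n] N[OF that(1)] N[OF that(2)] by linarith
    then show ?thesis by blast
  qed
  from L2_complete[OF s this] obtain l where l: "L2_on UNIV l" "(\<lambda>n. L2_norm_on UNIV (\<lambda>x. ?s n x - l x)) \<longlonglongrightarrow> 0"
    by blast
  then show ?thesis
    unfolding is_L2_ftrans_def using L2_norm_diff_commute[OF l(1) s] by auto
qed

lemma is_L2_ftrans_some: "\<lbrakk>L2_on UNIV f; \<bar>\<sigma>\<bar> = 1\<rbrakk> \<Longrightarrow> is_L2_ftrans \<sigma> f (L2_ftrans \<sigma> f)"
  unfolding L2_ftrans_def by (rule someI_ex[where P="is_L2_ftrans \<sigma> f"]) (rule L2_ftrans_exists)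

lemma L2_ftrans_L2: "\<lbrakk>L2_on UNIV f; \<bar>\<sigma>\<bar> = 1\<rbrakk> \<Longrightarrow> L2_on UNIV (L2_ftrans \<sigma> f)"
  using is_L2_ftrans_some is_L2_ftrans_def by blast

lemma is_L2_ftrans_unique:
  assumes "L2_on UNIV f" "\<bar>\<sigma>\<bar> = 1" "is_L2_ftrans \<sigma> f \<phi>"
  shows "AE \<omega> in lborel. L2_ftrans \<sigma> f \<omega> = \<phi> \<omega>"
  using is_L2_ftrans_some[OF assms(1,2)] assms(3) unfolding is_L2_ftrans_def
  by (intro L2_limit_unique[where g="\<lambda>n. ftrans \<sigma> (truncate n f)"] L2_ftrans_truncate assms) auto

lemma L2_ftrans_integrable:
  assumes f: "L2_on UNIV f" "integrable lborel f" and \<sigma>: "\<bar>\<sigma>\<bar> = 1"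
  shows "AE \<omega> in lborel. L2_ftrans \<sigma> f \<omega> = ftrans \<sigma> f \<omega>"
proof (rule is_L2_ftrans_unique[OF f(1) \<sigma>])
  have "(\<lambda>n. L2_norm_on UNIV (\<lambda>\<omega>. ftrans \<sigma> f \<omega> - ftrans \<sigma> (truncate n f) \<omega>)) \<longlonglongrightarrow> 0"
  proof (rule tendsto_sandwich[OF _ _ tendsto_const truncate_tendsto[OF f(1)]])
    show "\<forall>\<^sub>F n in sequentially. L2_norm_on UNIV (\<lambda>\<omega>. ftrans \<sigma> f \<omega> - ftrans \<sigma> (truncate n f) \<omega>)
        \<le> L2_norm_on UNIV (\<lambda>x. f x - truncate n f x)"
      using ftrans_diff_norm[OF f(2,1) integrable_truncate[OF f(1)] L2_truncate[OF f(1)] \<sigma>] by simp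
  qed (simp add: L2_norm_nonneg)
  then show "is_L2_ftrans \<sigma> f (ftrans \<sigma> f)"
    unfolding is_L2_ftrans_def using ftrans_contraction(1)[OF f(2,1) \<sigma>] by simp
qed

lemma L2_ftrans_cong_AE:
  assumes "AE x in lborel. f x = g x" and [measurable]: "f \<in> borel_measurable borel" "g \<in> borel_measurable borel"
  shows "L2_ftrans \<sigma> f = L2_ftrans \<sigma> g"
proof -
  have "ftrans \<sigma> (truncate n f) \<omega> = ftrans \<sigma> (truncate n g) \<omega>" for n \<omega>
    unfolding ftrans_def using assms(1)
    by (intro integral_cong_AE) (measurable, auto simp: truncate_def)
  then show ?thesis by (simp add: L2_ftrans_def is_L2_ftrans_def)
qed

lemma L2_multiplication_formula:
  assumes f: "L2_on UNIV f" and g: "L2_on UNIV g" and \<sigma>: "\<bar>\<sigma>\<bar> = 1"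
  shows "(LINT x|lborel. L2_ftrans \<sigma> f x * g x) = (LINT x|lborel. f x * L2_ftrans \<sigma> g x)"
proof (rule LIMSEQ_unique)
  have F: "L2_on UNIV (L2_ftrans \<sigma> f)" "(\<lambda>n. L2_norm_on UNIV (\<lambda>\<omega>. L2_ftrans \<sigma> f \<omega> - ftrans \<sigma> (truncate n f) \<omega>)) \<longlonglongrightarrow> 0"
    and G: "L2_on UNIV (L2_ftrans \<sigma> g)" "(\<lambda>n. L2_norm_on UNIV (\<lambda>\<omega>. L2_ftrans \<sigma> g \<omega> - ftrans \<sigma> (truncate n g) \<omega>)) \<longlonglongrightarrow> 0"
    using is_L2_ftrans_some[OF f \<sigma>] is_L2_ftrans_some[OF g \<sigma>] by (auto simp: is_L2_ftrans_def)
  have "(LINT x|lborel. ftrans \<sigma> (truncate n f) x * truncate n g x) = (LINT x|lborel. truncate n f x * ftrans \<sigma> (truncate n g) x)" for n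
    by (intro multiplication_formula integrable_truncate f g)
  then show "(\<lambda>n. LINT x|lborel. truncate n f x * ftrans \<sigma> (truncate n g) x) \<longlonglongrightarrow> (LINT x|lborel. L2_ftrans \<sigma> f x * g x)"
    using L2_pairing_tendsto[OF F(1) L2_ftrans_truncate[OF f \<sigma>] F(2) g L2_truncate[OF g] truncate_tendsto[OF g]] by simp
  show "(\<lambda>n. LINT x|lborel. truncate n f x * ftrans \<sigma> (truncate n g) x) \<longlonglongrightarrow> (LINT x|lborel. f x * L2_ftrans \<sigma> g x)"
    by (rule L2_pairing_tendsto[OF f L2_truncate[OF f] truncate_tendsto[OF f] G(1) L2_ftrans_truncate[OF g \<sigma>] G(2)])
qed

lemma L2_multiplication_formula_integrable:
  assumes f: "L2_on UNIV f" and g: "L2_on UNIV g" "integrable lborel g" and \<sigma>: "\<bar>\<sigma>\<bar> = 1"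
  shows "(LINT x|lborel. L2_ftrans \<sigma> f x * g x) = (LINT x|lborel. f x * ftrans \<sigma> g x)"
proof -
  note [measurable] = L2_measurable[OF f] L2_measurable[OF g(1)] L2_measurable[OF L2_ftrans_L2[OF g(1) \<sigma>]]
  have "(LINT x|lborel. f x * L2_ftrans \<sigma> g x) = (LINT x|lborel. f x * ftrans \<sigma> g x)"
    using L2_ftrans_integrable[OF g \<sigma>] by (intro integral_cong_AE) auto
  then show ?thesis using L2_multiplication_formula[OF f g(1) \<sigma>] by simp
qed

text \<open>
  Pairings with Gaussians identify a square integrable function, so identities between transforms
  need to be checked against Gaussians only, where the transforms are explicit integrals.
\<close>

lemma L2_eqI_gauss:
  assumes f: "L2_on UNIV f" and g: "L2_on UNIV g"
    and eq: "\<And>a s. 0 < s \<Longrightarrow> (LINT x|lborel. f x * of_real (gauss s a x)) = (LINT x|lborel. g x * of_real (gauss s a x))"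
  shows "AE x in lborel. f x = g x"
proof -
  have "AE x in lborel. f x - g x = 0"
  proof (rule gauss_orthogonal_L2_zero[OF L2_diff[OF f g]])
    fix a :: 'a and s :: real assume s: "0 < s"
    have "(LINT x|lborel. of_real (gauss s a x) * (f x - g x)) =
        (LINT x|lborel. f x * of_real (gauss s a x) - g x * of_real (gauss s a x))"
      by (simp add: algebra_simps)
    also have "\<dots> = 0"
      using f g s eq by (subst Bochner_Integration.integral_diff) (auto intro!: L2_mult_integrable L2_gauss)
    finally show "(LINT x|lborel. of_real (gauss s a x) * (f x - g x)) = 0" .
  qed
  then show ?thesis by simp
qed

text \<open>
  By symmetry of the pairing, both transforms pass to the Gaussian \<open>?g\<close>. Its transform is \<open>C\<close> times the
  modulated Gaussian \<open>?u\<close>, and the transform of opposite sign takes that back to \<open>?g\<close>.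
\<close>

lemma L2_ftrans_inverse:
  assumes f: "L2_on UNIV f" and \<sigma>: "\<bar>\<sigma>\<bar> = 1"
  shows "AE x in lborel. L2_ftrans (- \<sigma>) (L2_ftrans \<sigma> f) x = f x"
proof (rule L2_eqI_gauss[OF _ f])
  have \<sigma>': "\<bar>- \<sigma>\<bar> = 1" using \<sigma> by simp
  show "L2_on UNIV (L2_ftrans (- \<sigma>) (L2_ftrans \<sigma> f))"
    by (intro L2_ftrans_L2 f \<sigma> \<sigma>')
  fix a :: 'a and s :: real assume s: "0 < s"
  let ?g = "\<lambda>x. complex_of_real (gauss s a x)"
  define C where "C = complex_of_real ((1 / sqrt s) ^ DIM('a))"
  let ?u = "\<lambda>\<omega>::'a. cis (\<sigma> * (2 * pi * (\<omega> \<bullet> (- a)))) * of_real (gauss (1 / s) 0 \<omega>)"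
  have u: "integrable lborel ?u" "L2_on UNIV ?u"
    using s by (auto intro!: integrable_cis_mult integrable_gauss_complex L2_bounded_mult(1)[where C=1] L2_gauss)
  have Fg: "ftrans (- \<sigma>) ?g = (\<lambda>\<omega>. C * ?u \<omega>)"
    using ftrans_gauss[OF s \<sigma>'] by (auto simp: C_def)
  have Cu: "C * ftrans \<sigma> ?u x = ?g x" for x
  proof -
    have "gauss s 0 (- a + x) = gauss s a x" by (simp add: gauss_def)
    moreover have "(1 / sqrt s) ^ DIM('a) * (1 / sqrt (1 / s)) ^ DIM('a) = 1"
      using s by (simp add: real_sqrt_divide flip: power_mult_distrib)
    then have "C * of_real ((1 / sqrt (1 / s)) ^ DIM('a)) = 1"
      unfolding C_def of_real_mult[symmetric] by simp
    ultimately show ?thesis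
      unfolding ftrans_modulate using s \<sigma> ftrans_gauss[of "1 / s" \<sigma> 0 "- a + x"]
      by (simp add: mult.assoc[symmetric])
  qed
  have "(LINT x|lborel. L2_ftrans (- \<sigma>) (L2_ftrans \<sigma> f) x * ?g x) = (LINT x|lborel. L2_ftrans \<sigma> f x * ftrans (- \<sigma>) ?g x)"
    using s by (intro L2_multiplication_formula_integrable L2_ftrans_L2 L2_gauss integrable_gauss_complex f \<sigma> \<sigma>')
  also have "\<dots> = C * (LINT x|lborel. L2_ftrans \<sigma> f x * ?u x)"
    unfolding Fg by (subst integral_mult_right_zero[symmetric]) (simp only: mult_ac)
  also have "\<dots> = C * (LINT x|lborel. f x * ftrans \<sigma> ?u x)"
    by (subst L2_multiplication_formula_integrable[OF f u(2,1) \<sigma>]) (rule refl)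
  also have "\<dots> = (LINT x|lborel. f x * (C * ftrans \<sigma> ?u x))"
    by (subst integral_mult_right_zero[symmetric]) (simp only: mult_ac)
  finally show "(LINT x|lborel. L2_ftrans (- \<sigma>) (L2_ftrans \<sigma> f) x * ?g x) = (LINT x|lborel. f x * ?g x)"
    by (simp only: Cu)
qed

lemma L2_ftrans_cnj:
  assumes f: "L2_on UNIV f" and \<sigma>: "\<bar>\<sigma>\<bar> = 1"
  shows "AE \<omega> in lborel. L2_ftrans (- \<sigma>) (\<lambda>x. cnj (f x)) \<omega> = cnj (L2_ftrans \<sigma> f \<omega>)"
proof (rule is_L2_ftrans_unique[OF L2_cnj[OF f]])
  have "truncate n (\<lambda>x. cnj (f x)) = (\<lambda>x. cnj (truncate n f x))" for n
    by (simp add: truncate_def fun_eq_iff)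
  then have "L2_norm_on UNIV (\<lambda>\<omega>. cnj (L2_ftrans \<sigma> f \<omega>) - ftrans (- \<sigma>) (truncate n (\<lambda>x. cnj (f x))) \<omega>)
     = L2_norm_on UNIV (\<lambda>\<omega>. L2_ftrans \<sigma> f \<omega> - ftrans \<sigma> (truncate n f) \<omega>)" for n
    using L2_norm_cnj[of "\<lambda>\<omega>. L2_ftrans \<sigma> f \<omega> - ftrans \<sigma> (truncate n f) \<omega>"] by (simp add: ftrans_cnj)
  then show "is_L2_ftrans (- \<sigma>) (\<lambda>x. cnj (f x)) (\<lambda>\<omega>. cnj (L2_ftrans \<sigma> f \<omega>))"
    using is_L2_ftrans_some[OF f \<sigma>] by (simp add: is_L2_ftrans_def L2_cnj)
qed (use \<sigma> in simp)

lemma L2_parseval: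
  assumes f: "L2_on UNIV f" and g: "L2_on UNIV g" and \<sigma>: "\<bar>\<sigma>\<bar> = 1"
  shows "(LINT \<omega>|lborel. L2_ftrans \<sigma> f \<omega> * cnj (L2_ftrans \<sigma> g \<omega>)) = (LINT x|lborel. f x * cnj (g x))"
proof -
  have \<sigma>': "\<bar>- \<sigma>\<bar> = 1" using \<sigma> by simp
  let ?G = "L2_ftrans (- \<sigma>) (\<lambda>x. cnj (g x))"
  have G: "L2_on UNIV ?G" by (intro L2_ftrans_L2 L2_cnj g \<sigma>')
  have inv: "AE x in lborel. L2_ftrans \<sigma> ?G x = cnj (g x)"
    using L2_ftrans_inverse[OF L2_cnj[OF g] \<sigma>'] by simp
  note [measurable] = L2_measurable[OF L2_ftrans_L2[OF f \<sigma>]] L2_measurable[OF G] L2_measurable[OF f]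
    L2_measurable[OF L2_cnj[OF L2_ftrans_L2[OF g \<sigma>]]] L2_measurable[OF L2_ftrans_L2[OF G \<sigma>]] L2_measurable[OF L2_cnj[OF g]]
  have "(LINT \<omega>|lborel. L2_ftrans \<sigma> f \<omega> * cnj (L2_ftrans \<sigma> g \<omega>)) = (LINT \<omega>|lborel. L2_ftrans \<sigma> f \<omega> * ?G \<omega>)"
    using L2_ftrans_cnj[OF g \<sigma>] by (intro integral_cong_AE) auto
  also have "\<dots> = (LINT x|lborel. f x * L2_ftrans \<sigma> ?G x)"
    by (rule L2_multiplication_formula[OF f G \<sigma>])
  also have "\<dots> = (LINT x|lborel. f x * cnj (g x))"
    using inv by (intro integral_cong_AE) auto
  finally show ?thesis .
qed

lemma L2_translate:
  assumes f: "L2_on UNIV f" shows "L2_on UNIV (\<lambda>x. f (x - a))"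
proof -
  note [measurable] = L2_measurable[OF f]
  have "integrable lborel (\<lambda>x. (cmod (f (- a + x)))\<^sup>2)"
    using integrable_translate[of "\<lambda>x. (cmod (f x))\<^sup>2" "-a"] L2_square_integrable[OF f] by simp
  then show ?thesis by (simp add: L2_on_UNIV_iff)
qed

text \<open>
  Translation of \<open>f\<close> passes to the transform of the test function, where it is a modulation.
\<close>

lemma L2_ftrans_translate:
  assumes f: "L2_on UNIV f" and \<sigma>: "\<bar>\<sigma>\<bar> = 1"
  shows "AE \<omega> in lborel. L2_ftrans \<sigma> (\<lambda>x. f (x - y)) \<omega> = cis (\<sigma> * (2 * pi * (\<omega> \<bullet> y))) * L2_ftrans \<sigma> f \<omega>"
proof (rule L2_eqI_gauss)
  note [measurable] = L2_measurable[OF f]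
  show "L2_on UNIV (L2_ftrans \<sigma> (\<lambda>x. f (x - y)))" by (intro L2_ftrans_L2 L2_translate f \<sigma>)
  show "L2_on UNIV (\<lambda>\<omega>. cis (\<sigma> * (2 * pi * (\<omega> \<bullet> y))) * L2_ftrans \<sigma> f \<omega>)"
    by (rule L2_bounded_mult(1)[OF L2_ftrans_L2[OF f \<sigma>], where C=1]) auto
  fix a :: 'a and s :: real assume s: "0 < s"
  let ?g = "\<lambda>x. complex_of_real (gauss s a x)"
  let ?h = "\<lambda>\<omega>. cis (\<sigma> * (2 * pi * (\<omega> \<bullet> y))) * ?g \<omega>"
  have g: "L2_on UNIV ?g" "integrable lborel ?g" using s by (auto intro: L2_gauss integrable_gauss_complex)
  have h: "L2_on UNIV ?h" "integrable lborel ?h"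
    using s by (auto intro!: integrable_cis_mult L2_bounded_mult(1)[where C=1] L2_gauss integrable_gauss_complex)
  have [measurable]: "ftrans \<sigma> ?g \<in> borel_measurable borel" by (rule ftrans_measurable) simp
  have "(LINT x|lborel. L2_ftrans \<sigma> (\<lambda>x. f (x - y)) x * ?g x) = (LINT x|lborel. f (x - y) * ftrans \<sigma> ?g x)"
    by (rule L2_multiplication_formula_integrable[OF L2_translate[OF f] g \<sigma>])
  also have "\<dots> = (LINT x|lborel. f (y + x - y) * ftrans \<sigma> ?g (y + x))"
    by (rule integral_translate[symmetric]) simp
  also have "\<dots> = (LINT x|lborel. f x * ftrans \<sigma> ?h x)"
    unfolding ftrans_modulate by simp
  also have "\<dots> = (LINT x|lborel. L2_ftrans \<sigma> f x * ?h x)"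
    by (rule L2_multiplication_formula_integrable[OF f h \<sigma>, symmetric])
  finally show "(LINT x|lborel. L2_ftrans \<sigma> (\<lambda>x. f (x - y)) x * ?g x) =
      (LINT \<omega>|lborel. cis (\<sigma> * (2 * pi * (\<omega> \<bullet> y))) * L2_ftrans \<sigma> f \<omega> * ?g \<omega>)"
    by (simp add: mult_ac)
qed

section \<open>Native spaces of translation-invariant kernels\<close>

locale native_kernel_space =
  fixes K :: "'a::euclidean_space \<Rightarrow> complex" and H :: "('a \<Rightarrow> complex) set" and ip :: "'a inner_product"
  assumes K_L2: "L2_on UNIV K"
    and K_hat_pos: "AE \<omega> in lborel. Im (L2_fourier K \<omega>) = 0 \<and> 0 < Re (L2_fourier K \<omega>)"
    and native: "native_space K H ip"
    and embedded: "continuously_embedded_L2 H ip"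
begin

abbreviation "hat \<equiv> L2_ftrans (- 1)"

lemma rkhs_H: "rkhs H ip (\<lambda>x y. K (x - y))"
  using native by (simp add: native_space_def)

sublocale semi_inner_product H ip
proof
  have "fun_subspace H" and i: "inner_product_on H ip" using rkhs_H by (simp_all add: rkhs_def)
  note i = i[unfolded inner_product_on_def]
  show "fun_subspace H" by fact
  show "ip (\<lambda>x. f x + g x) h = ip f h + ip g h" if "f \<in> H" "g \<in> H" "h \<in> H" for f g h
    using conjunct1[OF i, rule_format, OF that] .
  show "ip (\<lambda>x. c * f x) h = c * ip f h" if "f \<in> H" "h \<in> H" for f h c
    using conjunct1[OF conjunct2[OF i], rule_format, OF that] .
  show "ip g f = cnj (ip f g)" if "f \<in> H" "g \<in> H" for f g
    using conjunct1[OF conjunct2[OF conjunct2[OF i]], rule_format, OF that] .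
  show "0 \<le> Re (ip f f)" if "f \<in> H" for f
    using conjunct2[OF conjunct2[OF conjunct2[OF i]], rule_format, OF that] by (rule conjunct1)
qed

lemma kernel_mem: "(\<lambda>x. K (x - y)) \<in> H"
  and reproducing: "f \<in> H \<Longrightarrow> ip f (\<lambda>x. K (x - y)) = f y"
  and complete: "ip_complete H ip"
  using rkhs_H unfolding rkhs_def by simp_all

lemma kernel_hermitian: "K (y - x) = cnj (K (x - y))"
  using hermitian[OF kernel_mem[of y] kernel_mem[of x]] by (simp add: reproducing kernel_mem)

lemma H_L2: "f \<in> H \<Longrightarrow> L2_on UNIV f"
  using embedded by (simp add: continuously_embedded_L2_def)

lemma L2_hat: "L2_on UNIV f \<Longrightarrow> L2_on UNIV (hat f)"
  by (rule L2_ftrans_L2) auto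

lemma K_hat: "AE \<omega> in lborel. hat K \<omega> \<noteq> 0 \<and> cnj (hat K \<omega>) = hat K \<omega>"
  using K_hat_pos unfolding L2_fourier_eq by eventually_elim (auto simp: complex_eq_iff)

lemma ip_hat:
  "\<lbrakk>f \<in> H; g \<in> H\<rbrakk> \<Longrightarrow> has_bochner_integral lborel (\<lambda>\<omega>. hat f \<omega> * cnj (hat g \<omega>) / hat K \<omega>) (ip f g)"
  using native by (simp add: native_space_def L2_fourier_eq)

text \<open>
  The conjugate is stated because it is what occurs in inner products with a kernel translate.
\<close>

lemma kernel_hat:
  "AE \<omega> in lborel. cnj (hat (\<lambda>x. K (x - y)) \<omega>) = cis (2 * pi * (\<omega> \<bullet> y)) * hat K \<omega>"
  using L2_ftrans_translate[OF K_L2, of "- 1" y] K_hat by (auto elim!: eventually_elim2 simp: cis_cnj)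

text \<open>
  In the reproducing formula, written with the Fourier form of the inner product, the transform of
  the kernel cancels. What remains is Fourier inversion with an absolutely convergent integral.
\<close>

lemma
  assumes f: "f \<in> H"
  shows integrable_hat: "integrable lborel (hat f)"
    and inversion: "f y = ftrans 1 (hat f) y"
proof -
  note [measurable] = L2_measurable[OF L2_hat[OF H_L2[OF f]]] L2_measurable[OF L2_hat[OF K_L2]]
    L2_measurable[OF L2_cnj[OF L2_hat[OF H_L2[OF kernel_mem]]]]
  have h: "has_bochner_integral lborel (\<lambda>\<omega>. cis (2 * pi * (\<omega> \<bullet> y)) * hat f \<omega>) (f y)" for y
  proof -
    have "AE \<omega> in lborel. hat f \<omega> * cnj (hat (\<lambda>x. K (x - y)) \<omega>) / hat K \<omega> = cis (2 * pi * (\<omega> \<bullet> y)) * hat f \<omega>"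
      using kernel_hat[of y] K_hat by eventually_elim simp
    then show ?thesis
      using ip_hat[OF f kernel_mem[of y]] unfolding reproducing[OF f]
      by (subst (asm) has_bochner_integral_cong_AE) auto
  qed
  show "integrable lborel (hat f)" using h[of 0] by (simp add: has_bochner_integral_iff)
  show "f y = ftrans 1 (hat f) y" using h[of y] by (simp add: has_bochner_integral_iff ftrans_def)
qed

lemma pairing_kernel:
  assumes u: "L2_on UNIV u"
  shows "(LINT x|lborel. u x * cnj (K (x - y))) = ftrans 1 (\<lambda>\<omega>. hat u \<omega> * hat K \<omega>) y"
proof -
  note [measurable] = L2_measurable[OF L2_hat[OF u]] L2_measurable[OF L2_hat[OF K_L2]]
    L2_measurable[OF L2_cnj[OF L2_hat[OF H_L2[OF kernel_mem]]]]
  have "(LINT x|lborel. u x * cnj (K (x - y))) = (LINT \<omega>|lborel. hat u \<omega> * cnj (hat (\<lambda>x. K (x - y)) \<omega>))"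
    by (rule L2_parseval[symmetric]) (auto intro: u H_L2 kernel_mem)
  also have "\<dots> = (LINT \<omega>|lborel. cis (2 * pi * (\<omega> \<bullet> y)) * (hat u \<omega> * hat K \<omega>))"
    using kernel_hat[of y] by (intro integral_cong_AE) (auto elim!: eventually_mono)
  finally show ?thesis by (simp add: ftrans_def)
qed

lemma integrable_hat_mult_K: "L2_on UNIV u \<Longrightarrow> integrable lborel (\<lambda>\<omega>. hat u \<omega> * hat K \<omega>)"
  by (intro L2_mult_integrable L2_hat K_L2)

text \<open>
  The convolution theorem. The functions \<open>hat f\<close> and \<open>hat v\<close> times \<open>hat K\<close> are both integrable, and \<open>f\<close> is the
  inverse Fourier integral of each, of the first by \<open>inversion\<close> and of the second because convolution
  with \<open>K\<close> is the inner product with kernel translates.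
\<close>

lemma hat_convolution:
  assumes f: "f \<in> H" and v: "L2_on UNIV v" and conv: "\<And>x. f x = (LINT y|lborel. K (x - y) * v y)"
  shows "AE \<omega> in lborel. hat f \<omega> / hat K \<omega> = hat v \<omega>"
proof -
  let ?d = "\<lambda>\<omega>. hat f \<omega> - hat v \<omega> * hat K \<omega>"
  have "AE \<omega> in lborel. ?d \<omega> = 0"
  proof (rule ftrans_injective[where \<sigma>=1])
    show "integrable lborel ?d"
      by (intro Bochner_Integration.integrable_diff integrable_hat integrable_hat_mult_K f v)
    fix y
    have "f y = (LINT x|lborel. v x * cnj (K (x - y)))"
      unfolding conv kernel_hermitian[of y] by (simp add: mult.commute)
    then show "ftrans 1 ?d y = 0"
      using inversion[OF f, of y] pairing_kernel[OF v, of y]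
      by (subst ftrans_diff) (simp_all add: integrable_hat integrable_hat_mult_K f v)
  qed simp
  with K_hat show ?thesis by eventually_elim simp
qed

lemma pseudo_op_convolution:
  assumes f: "f \<in> H" and v: "L2_on UNIV v" and conv: "\<And>x. f x = (LINT y|lborel. K (x - y) * v y)"
  shows "AE x in lborel. pseudo_op K f x = v x"
proof -
  note [measurable] = L2_measurable[OF L2_hat[OF v]] L2_measurable[OF L2_hat[OF K_L2]]
    L2_measurable[OF L2_hat[OF H_L2[OF f]]]
  have "pseudo_op K f = L2_ftrans 1 (hat v)"
    unfolding pseudo_op_def L2_fourier_eq L2_inv_fourier_eq
    by (rule L2_ftrans_cong_AE[OF hat_convolution[OF assms]]) measurable
  then show ?thesis using L2_ftrans_inverse[OF v, of "- 1"] by simp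
qed

lemma ip_convolution:
  assumes f: "f \<in> H" and v: "L2_on UNIV v" and conv: "\<And>x. f x = (LINT y|lborel. K (x - y) * v y)"
    and g: "g \<in> H"
  shows "ip f g = L2_ip v g"
proof -
  note [measurable] = L2_measurable[OF L2_hat[OF v]] L2_measurable[OF L2_hat[OF K_L2]]
    L2_measurable[OF L2_hat[OF H_L2[OF f]]] L2_measurable[OF L2_cnj[OF L2_hat[OF H_L2[OF g]]]] L2_measurable[OF L2_hat[OF H_L2[OF g]]]
  have "ip f g = (LINT \<omega>|lborel. hat f \<omega> * cnj (hat g \<omega>) / hat K \<omega>)"
    using ip_hat[OF f g] by (simp add: has_bochner_integral_iff)
  also have "\<dots> = (LINT \<omega>|lborel. hat v \<omega> * cnj (hat g \<omega>))"
  proof (rule integral_cong_AE)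
    show "AE \<omega> in lborel. hat f \<omega> * cnj (hat g \<omega>) / hat K \<omega> = hat v \<omega> * cnj (hat g \<omega>)"
      using hat_convolution[OF f v conv] by eventually_elim (simp only: times_divide_eq_left[symmetric])
  qed measurable
  also have "\<dots> = L2_ip v g"
    unfolding L2_ip_def by (rule L2_parseval) (auto intro: v H_L2 g)
  finally show ?thesis .
qed

text \<open>
  Orthogonality to the kernel translates alone makes the inverse Fourier integral of \<open>hat w\<close> times \<open>hat K\<close>
  vanish, and \<open>hat K\<close> has no zeros.
\<close>

lemma orthogonal_H_zero:
  assumes w: "L2_on UNIV w" and ortho: "\<And>h. h \<in> H \<Longrightarrow> L2_ip w h = 0"
  shows "AE x in lborel. w x = 0"
proof -
  note [measurable] = L2_measurable[OF L2_hat[OF w]]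
  have "AE \<omega> in lborel. hat w \<omega> * hat K \<omega> = 0"
    using ortho[OF kernel_mem] pairing_kernel[OF w]
    by (intro ftrans_injective[where \<sigma>=1] integrable_hat_mult_K w) (auto simp: L2_ip_def)
  with K_hat have "AE \<omega> in lborel. hat w \<omega> = 0" by eventually_elim simp
  then have "L2_ftrans 1 (hat w) = L2_ftrans 1 (\<lambda>\<omega>. 0)"
    by (rule L2_ftrans_cong_AE) measurable
  moreover have "AE x in lborel. L2_ftrans 1 (\<lambda>\<omega>::'a. 0) x = ftrans 1 (\<lambda>\<omega>. 0) x"
    by (rule L2_ftrans_integrable) (auto simp: L2_on_UNIV_iff)
  ultimately have "AE x in lborel. L2_ftrans 1 (hat w) x = 0" by (simp add: ftrans_def)
  moreover have "AE x in lborel. L2_ftrans 1 (hat w) x = w x"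
    using L2_ftrans_inverse[OF w, of "- 1"] by simp
  ultimately show ?thesis by eventually_elim simp
qed

text \<open>
  Project \<open>\<phi>\<close> onto the $L_2$ closure \<open>V\<close> of \<open>H\<close>. The residual is orthogonal to \<open>H\<close>, hence zero.
\<close>

lemma H_dense_L2:
  assumes \<phi>: "L2_on UNIV \<phi>" and e: "0 < e"
  shows "\<exists>h\<in>H. L2_norm_on UNIV (\<lambda>x. \<phi> x - h x) < e"
proof -
  define V where "V = {g. L2_on UNIV g \<and> (\<forall>e>0. \<exists>h\<in>H. L2_norm_on UNIV (\<lambda>x. g x - h x) < e)}"
  have VD: "\<exists>h\<in>H. L2_norm_on UNIV (\<lambda>x. g x - h x) < e" if "g \<in> V" "0 < e" for g e
    using that by (simp add: V_def)
  have VL: "V \<subseteq> Collect (L2_on UNIV)" by (auto simp: V_def)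
  have HV: "H \<subseteq> V"
    unfolding V_def using H_L2 by (auto simp: L2_norm_UNIV intro!: bexI)
  have "fun_subspace V"
    unfolding fun_subspace_def
  proof (intro conjI ballI allI)
    show "(\<lambda>x. 0) \<in> V" using HV subspace by (auto simp: fun_subspace_def)
  next
    fix f g assume f: "f \<in> V" and g: "g \<in> V"
    have "\<exists>h\<in>H. L2_norm_on UNIV (\<lambda>x. f x + g x - h x) < e" if "e > 0" for e
    proof -
      obtain h1 h2 where h: "h1 \<in> H" "h2 \<in> H" "L2_norm_on UNIV (\<lambda>x. f x - h1 x) < e / 2" "L2_norm_on UNIV (\<lambda>x. g x - h2 x) < e / 2"
        using VD[OF f, of "e / 2"] VD[OF g, of "e / 2"] \<open>e > 0\<close> by auto
      have "L2_norm_on UNIV (\<lambda>x. (f x - h1 x) + (g x - h2 x)) < e"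
        using L2_norm_triangle[OF L2_diff[of f h1] L2_diff[of g h2]] f g h H_L2 by (auto simp: V_def)
      then show ?thesis using add_mem[OF h(1,2)]
        by (intro bexI[of _ "\<lambda>x. h1 x + h2 x"]) (simp_all add: algebra_simps)
    qed
    then show "(\<lambda>x. f x + g x) \<in> V" using f g L2_add by (auto simp: V_def)
  next
    fix f c assume f: "f \<in> V"
    have "\<exists>h\<in>H. L2_norm_on UNIV (\<lambda>x. c * f x - h x) < e" if "e > 0" for e
    proof -
      obtain h where h: "h \<in> H" "L2_norm_on UNIV (\<lambda>x. f x - h x) < e / (cmod c + 1)"
        using VD[OF f, of "e / (cmod c + 1)"] \<open>e > 0\<close> by (auto simp: add_nonneg_pos)
      have "L2_norm_on UNIV (\<lambda>x. c * f x - c * h x) = cmod c * L2_norm_on UNIV (\<lambda>x. f x - h x)"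
        using L2_norm_on_scale[of UNIV c "\<lambda>x. f x - h x"] by (simp add: right_diff_distrib)
      also have "\<dots> \<le> cmod c * (e / (cmod c + 1))" using h by (intro mult_left_mono) auto
      also have "\<dots> < e" using \<open>e > 0\<close> by (simp add: field_simps add_pos_nonneg)
      finally show ?thesis using scale_mem[OF h(1), of c] by (intro bexI[of _ "\<lambda>x. c * h x"]) simp_all
    qed
    then show "(\<lambda>x. c * f x) \<in> V" using f L2_scale by (auto simp: V_def)
  qed
  moreover have "ip_complete V L2_ip"
    unfolding ip_complete_def L2_ip_norm
  proof (intro allI impI, elim conjE)
    fix s :: "nat \<Rightarrow> 'a \<Rightarrow> complex"
    assume s: "\<forall>n. s n \<in> V" and c: "\<forall>e>0. \<exists>N. \<forall>m\<ge>N. \<forall>n\<ge>N. L2_norm_on UNIV (\<lambda>x. s m x - s n x) < e"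
    have sL: "L2_on UNIV (s n)" for n using s by (auto simp: V_def)
    obtain l where l: "L2_on UNIV l" "(\<lambda>n. L2_norm_on UNIV (\<lambda>x. s n x - l x)) \<longlonglongrightarrow> 0"
      using L2_complete[OF sL c[rule_format]] by auto
    have "\<exists>h\<in>H. L2_norm_on UNIV (\<lambda>x. l x - h x) < e" if "e > 0" for e
    proof -
      obtain n where n: "L2_norm_on UNIV (\<lambda>x. s n x - l x) < e / 2"
        using LIMSEQ_D[OF l(2), of "e / 2"] \<open>e > 0\<close> by (auto simp: L2_norm_nonneg)
      have "s n \<in> V" using s by blast
      then obtain h where h: "h \<in> H" "L2_norm_on UNIV (\<lambda>x. s n x - h x) < e / 2"
        using VD[of "s n" "e / 2"] \<open>e > 0\<close> by auto
      have "L2_norm_on UNIV (\<lambda>x. l x - h x) < e"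
        using L2_norm_diff_triangle[OF l(1) sL[of n] H_L2[OF h(1)]] L2_norm_diff_commute[OF l(1) sL[of n]] n h
        by linarith
      with h show ?thesis by blast
    qed
    with l show "\<exists>l\<in>V. (\<lambda>n. L2_norm_on UNIV (\<lambda>x. s n x - l x)) \<longlonglongrightarrow> 0"
      by (auto simp: V_def)
  qed
  ultimately obtain p where p: "p \<in> V" "\<And>h. h \<in> V \<Longrightarrow> L2_ip (\<lambda>x. \<phi> x - p x) h = 0"
    using L2.projection_exists[OF VL, of \<phi>] \<phi> by blast
  have pL: "L2_on UNIV p" using p VL by blast
  have "AE x in lborel. \<phi> x - p x = 0"
    by (rule orthogonal_H_zero[OF L2_diff[OF \<phi> pL]]) (use p HV in auto)
  then have ae: "AE x in lborel. \<phi> x = p x" by eventually_elim simp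
  obtain h where h: "h \<in> H" "L2_norm_on UNIV (\<lambda>x. p x - h x) < e"
    using VD[OF p(1) e] by blast
  note [measurable] = L2_measurable[OF \<phi>] L2_measurable[OF pL] L2_measurable[OF H_L2[OF h(1)]]
  have "L2_norm_on UNIV (\<lambda>x. \<phi> x - h x) = L2_norm_on UNIV (\<lambda>x. p x - h x)"
    using ae by (intro L2_norm_cong_AE) (auto elim: eventually_mono)
  with h show ?thesis by (intro bexI[of _ h]) simp_all
qed

section \<open>Consequences of superconvergence\<close>

lemma continuous_H: "h \<in> H \<Longrightarrow> continuous_on UNIV h"
  using ftrans_continuous[OF integrable_hat[of h], of 1] inversion[of h] by simp

lemma norm_on_open_zero:
  assumes h: "h \<in> H" and \<Omega>: "open \<Omega>" and zero: "L2_norm_on \<Omega> h = 0" and x: "x \<in> \<Omega>"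
  shows "h x = 0"
proof (rule ccontr)
  assume nz: "h x \<noteq> 0"
  let ?U = "{x \<in> \<Omega>. h x \<noteq> 0}"
  have "?U = \<Omega> \<inter> h -` (- {0})" by auto
  moreover have "open (h -` (- {0}))"
    using open_vimage[OF _ continuous_H[OF h]] by auto
  ultimately have "open ?U" using \<Omega> by (simp add: open_Int)
  have "AE x in lborel. of_real (indicator \<Omega> x) * h x = 0"
    using zero \<Omega> unfolding L2_norm_on_eq_UNIV[of \<Omega>]
    by (intro L2_norm_zero_AE L2_restrict(1) H_L2 h) auto
  then have "AE x in lborel. x \<notin> ?U"
    by eventually_elim (auto simp: indicator_def split: if_splits)
  then have "?U \<in> null_sets lborel"
    using AE_iff_null_sets[of ?U lborel] \<open>open ?U\<close> by simp
  then have "negligible ?U" by (simp add: negligible_iff_null_sets null_sets_completionI)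
  then show False using open_not_negligible[OF \<open>open ?U\<close>] nz x by auto
qed

text \<open>
  For a unit vector \<open>e\<close> of the localized space, \<open>V\<close> is the orthogonal complement of \<open>e\<close> there, and \<open>\<epsilon>\<close>
  is the $L_2(\Omega)$ norm of \<open>e\<close>, the best constant in the standard error bound. The residual of \<open>g\<close> consists of
  \<open>ip g e\<close> times \<open>e\<close> and a part that vanishes on \<open>\<Omega>\<close>. Passing from \<open>e\<close> to an arbitrary \<open>h\<close> changes
  \<open>h\<close> only by a function that vanishes on \<open>\<Omega>\<close>, to which \<open>f\<close> is orthogonal.
\<close>

lemma superconvergent_bound:
  assumes \<Omega>: "open \<Omega>" and f: "f \<in> localized H ip \<Omega>" and super: "superconvergent K H ip \<Omega> f" and h: "h \<in> H"
  shows "cmod (ip f h) \<le> L2_norm_on UNIV (pseudo_op K f) * L2_norm_on \<Omega> h"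
proof -
  let ?Z = "vanishing_on H \<Omega>" and ?loc = "localized H ip \<Omega>" and ?M = "L2_norm_on UNIV (pseudo_op K f)"
  have ZH: "?Z \<subseteq> H" by (auto simp: vanishing_on_def)
  have loc: "g \<in> H" "z \<in> ?Z \<Longrightarrow> ip g z = 0" if "g \<in> ?loc" for g z
    using that by (auto simp: localized_def)
  have fH: "f \<in> H" using loc f by blast
  have "closed_subspace H ip ?loc"
    unfolding localized_def by (rule annihilator_closed[OF ZH])
  from orth_projector_exists[OF this complete] obtain L where "orth_projector H ip ?loc L" ..
  then have L: "\<And>g. g \<in> H \<Longrightarrow> L g \<in> ?loc"
    "\<And>g k. g \<in> H \<Longrightarrow> k \<in> ?loc \<Longrightarrow> ip (\<lambda>x. g x - L g x) k = 0"
    by (auto simp: orth_projector_def)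
  have LH: "L g \<in> H" if "g \<in> H" for g using L(1)[OF that] loc by blast
  have L_eq: "L g x = g x" if g: "g \<in> H" and x: "x \<in> \<Omega>" for g x
  proof -
    have "ip (\<lambda>t. K (t - x)) z = 0" if "z \<in> ?Z" for z
      using that x hermitian[of z "\<lambda>t. K (t - x)"] kernel_mem[of x] reproducing[of z x]
      by (auto simp: vanishing_on_def)
    then have "(\<lambda>t. K (t - x)) \<in> ?loc" by (simp add: localized_def kernel_mem)
    from L(2)[OF g this] show ?thesis by (simp add: reproducing diff_mem LH g)
  qed
  have unit: "cmod (ip f e) \<le> ?M * L2_norm_on \<Omega> e" if e: "e \<in> ?loc" "ip e e = 1" for e
  proof -
    have eH: "e \<in> H" using loc e by blast
    have e1: "ip_norm ip e = 1" by (simp add: ip_norm_def e)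
    define \<epsilon> where "\<epsilon> = L2_norm_on \<Omega> e"
    \<comment> \<open>Otherwise \<open>e\<close> vanishes on \<open>\<Omega>\<close> and is orthogonal to itself.\<close>
    have "\<epsilon> \<noteq> 0"
    proof
      assume "\<epsilon> = 0"
      then have "e \<in> ?Z" using norm_on_open_zero[OF eH \<Omega>] eH by (auto simp: \<epsilon>_def vanishing_on_def)
      then show False using loc(2)[OF e(1)] e(2) by simp
    qed
    then have \<epsilon>: "\<epsilon> > 0" using L2_norm_nonneg[of \<Omega> e] by (simp add: \<epsilon>_def)
    define V where "V = {g \<in> H. \<forall>z\<in>insert e ?Z. ip g z = 0}"
    define P where "P g = (\<lambda>x. L g x - ip g e * e x)" for g
    have V: "closed_subspace H ip V" unfolding V_def using ZH eH by (intro annihilator_closed) auto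
    have V_loc: "V \<subseteq> ?loc" by (auto simp: V_def localized_def)
    have split: "(\<lambda>x. g x - P g x) = (\<lambda>x. (g x - L g x) + ip g e * e x)" for g
      by (auto simp: P_def)
    have residual: "(\<lambda>x. g x - P g x) \<in> H"
      "k \<in> H \<Longrightarrow> ip (\<lambda>x. g x - P g x) k = ip (\<lambda>x. g x - L g x) k + ip g e * ip e k" if "g \<in> H" for g k
      unfolding split using that eH LH
      by (auto simp: add_mem diff_mem scale_mem add_left scale_left)
    have proj: "orth_projector H ip V P"
      unfolding orth_projector_def
    proof (intro ballI conjI)
      fix g assume g: "g \<in> H"
      have PH: "P g \<in> H" unfolding P_def by (intro diff_mem scale_mem LH g eH)
      have Pk: "ip (P g) k = ip (L g) k - ip g e * ip e k" if "k \<in> H" for k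
        unfolding P_def using that by (simp add: diff_left scale_left scale_mem LH g eH)
      have "ip (L g) e = ip g e" using L(2)[OF g e(1)] by (simp add: diff_left g LH eH)
      then show "P g \<in> V"
        unfolding V_def using PH Pk eH ZH e loc L(1)[OF g] by auto
      fix k assume k: "k \<in> V"
      then have kH: "k \<in> H" and "k \<in> ?loc" and "ip k e = 0" using V_loc by (auto simp: V_def)
      then show "ip (\<lambda>x. g x - P g x) k = 0"
        using residual(2)[OF g kH] L(2)[OF g] hermitian[OF kH eH] by simp
    qed
    have on_\<Omega>: "L2_norm_on \<Omega> (\<lambda>x. g x - P g x) = cmod (ip g e) * \<epsilon>" if "g \<in> H" for g
      unfolding \<epsilon>_def L2_norm_on_scale[symmetric] split
      by (rule L2_norm_on_cong) (simp add: L_eq that)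
    have "L2_norm_on \<Omega> (\<lambda>x. g x - P g x) \<le> \<epsilon> * ip_norm ip (\<lambda>x. g x - P g x)" if g: "g \<in> H" for g
    proof -
      have "ip (\<lambda>x. g x - P g x) e = ip g e"
        using residual(2)[OF g eH] L(2)[OF g e(1)] e(2) by simp
      then have "cmod (ip g e) \<le> ip_norm ip (\<lambda>x. g x - P g x)"
        using cauchy_schwarz[OF residual(1)[OF g] eH] e1 by simp
      then show ?thesis unfolding on_\<Omega>[OF g] using \<epsilon> by (simp add: mult.commute)
    qed
    then have "L2_norm_on \<Omega> (\<lambda>x. f x - P f x) \<le> \<epsilon>\<^sup>2 * ?M"
      using super[unfolded superconvergent_def, rule_format, of V P \<epsilon>] V V_loc proj \<epsilon> by simp
    then have "\<epsilon> * cmod (ip f e) \<le> \<epsilon> * (?M * \<epsilon>)"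
      unfolding on_\<Omega>[OF fH] by (simp add: power2_eq_square mult_ac)
    then show ?thesis using \<epsilon> unfolding \<epsilon>_def by (simp only: mult_le_cancel_left_pos)
  qed
  have fh: "ip f h = ip f (L h)"
  proof -
    have "(\<lambda>x. h x - L h x) \<in> ?Z" using L_eq[OF h] by (auto simp: vanishing_on_def intro!: diff_mem h LH)
    from loc(2)[OF f this] show ?thesis by (simp add: diff_right fH h LH)
  qed
  have h\<Omega>: "L2_norm_on \<Omega> (L h) = L2_norm_on \<Omega> h" by (rule L2_norm_on_cong) (rule L_eq[OF h])
  define N where "N = ip_norm ip (L h)"
  show ?thesis
  proof (cases "N = 0")
    case True
    then have "ip f (L h) = 0" using cauchy_schwarz[OF fH LH[OF h]] by (simp add: N_def)
    then show ?thesis by (simp add: fh L2_norm_nonneg)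
  next
    case False
    then have N: "N > 0" using norm_nonneg[OF LH[OF h]] by (simp add: N_def)
    let ?e = "\<lambda>x. of_real (1 / N) * L h x"
    have "?e \<in> ?loc"
      unfolding localized_def
    proof (intro CollectI conjI ballI)
      show "?e \<in> H" by (intro scale_mem LH h)
      fix z assume "z \<in> ?Z"
      then show "ip ?e z = 0"
        using scale_left[OF LH[OF h], of z "of_real (1 / N)"] loc(2)[OF L(1)[OF h]] ZH by auto
    qed
    moreover have "complex_of_real (1 / N) * (of_real (1 / N) * (of_real N * of_real N)) = 1"
      using False by simp
    then have "ip ?e ?e = 1"
      using ip_self[OF LH[OF h]] by (simp add: scale_left scale_right scale_mem LH h N_def[symmetric] power2_eq_square del: of_real_divide)
    ultimately have "cmod (ip f ?e) \<le> ?M * L2_norm_on \<Omega> ?e" by (rule unit)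
    then have "\<bar>1 / N\<bar> * cmod (ip f (L h)) \<le> \<bar>1 / N\<bar> * (?M * L2_norm_on \<Omega> (L h))"
      unfolding scale_right[OF LH[OF h] fH] L2_norm_on_scale norm_mult complex_mod_cnj norm_of_real
      by (simp only: mult.left_commute)
    then show ?thesis using N unfolding fh h\<Omega> by (simp add: divide_le_cancel)
  qed
qed

text \<open>
  Let \<open>h\<close> in \<open>H\<close> be close in $L_2$ to the part \<open>?\<phi>\<close> of \<open>v\<close> outside \<open>\<Omega>\<close>. Its norm over \<open>\<Omega>\<close> is then small, by
  \<open>superconvergent_bound\<close> so is its inner product with \<open>v\<close>, and in the limit so is the squared norm
  of \<open>?\<phi>\<close>.
\<close>

lemma convolution_factor_vanishes_outside:
  assumes \<Omega>: "open \<Omega>" and f: "f \<in> localized H ip \<Omega>" and super: "superconvergent K H ip \<Omega> f"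
    and v: "L2_on UNIV v" and conv: "\<And>x. f x = (LINT y|lborel. K (x - y) * v y)"
  shows "AE x in lborel. x \<notin> \<Omega> \<longrightarrow> v x = 0"
proof -
  have fH: "f \<in> H" using f by (simp add: localized_def)
  have [measurable]: "\<Omega> \<in> sets borel" using \<Omega> by simp
  let ?M = "L2_norm_on UNIV (pseudo_op K f)"
  let ?\<phi> = "\<lambda>x. of_real (indicator (- \<Omega>) x) * v x"
  have \<phi>: "L2_on UNIV ?\<phi>" by (rule L2_restrict(1)[OF v]) simp
  have "L2_ip v ?\<phi> = L2_ip ?\<phi> ?\<phi>"
    unfolding L2_ip_def by (intro Bochner_Integration.integral_cong) (auto simp: indicator_def)
  then have sq: "(L2_norm_on UNIV ?\<phi>)\<^sup>2 = cmod (L2_ip v ?\<phi>)"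
    using L2.ip_self[of ?\<phi>] \<phi> by (simp add: L2_ip_norm norm_power)
  have le: "(L2_norm_on UNIV ?\<phi>)\<^sup>2 \<le> e * (?M + L2_norm_on UNIV v)" if e: "0 < e" for e
  proof -
    obtain h where h: "h \<in> H" "L2_norm_on UNIV (\<lambda>x. ?\<phi> x - h x) < e"
      using H_dense_L2[OF \<phi> e] by blast
    note hL = H_L2[OF h(1)]
    have d: "L2_on UNIV (\<lambda>x. ?\<phi> x - h x)" by (rule L2_diff[OF \<phi> hL])
    have "L2_norm_on \<Omega> h = L2_norm_on \<Omega> (\<lambda>x. (- 1) * (?\<phi> x - h x))"
      by (rule L2_norm_on_cong) (simp add: indicator_def)
    also have "\<dots> \<le> L2_norm_on UNIV (\<lambda>x. ?\<phi> x - h x)"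
      unfolding L2_norm_on_scale using L2_restrict(2)[OF d, of \<Omega>] by simp
    finally have "L2_norm_on \<Omega> h \<le> e" using h(2) by simp
    then have 1: "cmod (L2_ip v h) \<le> ?M * e"
      using superconvergent_bound[OF \<Omega> f super h(1)] ip_convolution[OF fH v conv h(1)]
        mult_left_mono[OF _ L2_norm_nonneg, of "L2_norm_on \<Omega> h" e UNIV "pseudo_op K f"] by simp
    have 2: "cmod (L2_ip v (\<lambda>x. ?\<phi> x - h x)) \<le> L2_norm_on UNIV v * e"
      using L2_cauchy_schwarz[OF v d] mult_left_mono[OF less_imp_le[OF h(2)] L2_norm_nonneg[of UNIV v]]
      by (rule order_trans)
    have "L2_ip v ?\<phi> = L2_ip v (\<lambda>x. ?\<phi> x - h x) + L2_ip v h"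
      using L2.diff_right[of ?\<phi> h v] \<phi> hL v by simp
    with norm_triangle_le[OF add_mono[OF 2 1]]
    have "cmod (L2_ip v ?\<phi>) \<le> L2_norm_on UNIV v * e + ?M * e" by (simp only:)
    then show ?thesis unfolding sq by (simp only: distrib_left mult.commute add.commute)
  qed
  have "L2_norm_on UNIV ?\<phi> = 0"
  proof (rule ccontr)
    assume "L2_norm_on UNIV ?\<phi> \<noteq> 0"
    define S where "S = (L2_norm_on UNIV ?\<phi>)\<^sup>2"
    define B where "B = ?M + L2_norm_on UNIV v"
    have "S > 0" "B \<ge> 0" using \<open>L2_norm_on UNIV ?\<phi> \<noteq> 0\<close> by (auto simp: S_def B_def L2_norm_nonneg)
    then have "S / (B + 1) * B < S" by (simp add: field_simps)
    moreover have "S \<le> S / (B + 1) * B"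
      unfolding S_def B_def[symmetric] using le[of "S / (B + 1)"] \<open>S > 0\<close> \<open>B \<ge> 0\<close> by (simp add: S_def B_def)
    ultimately show False by simp
  qed
  from L2_norm_zero_AE[OF \<phi> this] show ?thesis
    by eventually_elim (auto simp: indicator_def)
qed

end

theorem corollary1:
  fixes K :: "'a::euclidean_space \<Rightarrow> complex"
    and H :: "('a \<Rightarrow> complex) set"
    and ip :: "('a \<Rightarrow> complex) \<Rightarrow> ('a \<Rightarrow> complex) \<Rightarrow> complex"
    and \<Omega> :: "'a set"
    and f :: "'a \<Rightarrow> complex"
  assumes "continuous_on UNIV K"
    and "strictly_positive_definite K"
    and "L2_on UNIV K"
    and "AE \<omega> in lborel. Im (L2_fourier K \<omega>) = 0 \<and> 0 < Re (L2_fourier K \<omega>)"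
    and "native_space K H ip"
    and "continuously_embedded_L2 H ip"
    and "open \<Omega>" and "connected \<Omega>" and "\<Omega> \<noteq> {}"
    and "f \<in> conv_space K \<inter> localized H ip \<Omega>"
    and "superconvergent K H ip \<Omega> f"
  shows "\<exists>v. L2_on \<Omega> v \<and> strong_solution K (zero_ext \<Omega> v) f"
proof -
  interpret native_kernel_space K H ip
    by unfold_locales (fact assms)+
  obtain v where v: "L2_on UNIV v" and conv: "\<And>x. f x = (LINT y|lborel. K (x - y) * v y)"
    using assms(10) by (auto simp: conv_space_def)
  have f: "f \<in> localized H ip \<Omega>" and fH: "f \<in> H" using assms(10) by (auto simp: localized_def)
  have [measurable]: "\<Omega> \<in> sets borel" using assms(7) by simp
  have ext: "zero_ext \<Omega> v = (\<lambda>x. of_real (indicator \<Omega> x) * v x)"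
    by (auto simp: zero_ext_def indicator_def)
  have zL: "L2_on UNIV (zero_ext \<Omega> v)" unfolding ext by (rule L2_restrict(1)[OF v]) simp
  have "AE x in lborel. pseudo_op K f x = zero_ext \<Omega> v x"
    using pseudo_op_convolution[OF fH v conv]
      convolution_factor_vanishes_outside[OF assms(7) f assms(11) v conv]
    by eventually_elim (auto simp: zero_ext_def)
  then have "strong_solution K (zero_ext \<Omega> v) f"
    using assms(10) zL by (simp add: strong_solution_def)
  moreover have "L2_on \<Omega> v"
  proof -
    have 1: "indicator \<Omega> x *\<^sub>R v x = of_real (indicator \<Omega> x) * v x" for x by (simp add: scaleR_conv_of_real)
    have 2: "indicator \<Omega> x *\<^sub>R (cmod (v x))\<^sup>2 = (cmod (of_real (indicator \<Omega> x) * v x))\<^sup>2" for x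
      by (simp add: indicator_def)
    show ?thesis
      using zL unfolding L2_on_UNIV_iff ext L2_on_def set_borel_measurable_def set_integrable_def 1 2 by simp
  qed
  ultimately show ?thesis by blast
qed

end
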